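(* Let $\gamma$ denote analytic capacity. The following two assertions are equivalent: (i) (Subadditivity of analytic capacity) For all compact sets $E, F \subset \mathbb{C}$, $$\gamma(E \cup F) \leq \gamma(E) + \gamma(F).$$ (ii) The inequality $$\gamma(E \cup F) \leq \gamma(E) + \gamma(F)$$ holds for all disjoint compact sets $E, F \subset \mathbb{C}$ that are finite unions of disjoint closed disks, all with the same radius; that is, for all disjoint $E, F$ such that there is a single $r>0$ for which each of $E$ and $F$ is a union of finitely many pairwise disjoint closed disks of radius $r$.
   Context: Let $\widehat{\mathbb{C}} = \mathbb{C} \cup \{\infty\}$ be the Riemann sphere. For a compact set $E \subset \mathbb{C}$, put $\Omega := \widehat{\mathbb{C}} \setminus E$ and let $H^\infty(\Omega)$ be the space of all bounded analytic functions on $\Omega$. The analytic capacity of $E$ is $$\gamma(E) := \sup\{ |f'(\infty)| : f \in H^\infty(\Omega),\ |f| \leq 1 \text{ on } \Omega \},$$ where $f'(\infty) := \lim_{z \to \infty} z\,(f(z) - f(\infty))$ is the coefficient of $1/z$ in the Laurent expansion of $f$ near $\infty$. A closed disk of radius $r>0$ is a set $\overline{\mathbb{D}}(z_0,r) = \{z \in \mathbb{C} : |z - z_0| \leq r\}$ with $z_0 \in \mathbb{C}$. *)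

theory Defs
  imports "HOL-Complex_Analysis.Complex_Analysis"
begin

text \<open>The Riemann sphere: \<^term>\<open>Some z\<close> is the finite point \<^term>\<open>z\<close>, and
  \<^term>\<open>None\<close> is the point at infinity.\<close>

type_synonym riemann_sphere = "complex option"

text \<open>The chart \<open>w \<mapsto> 1/w\<close> around infinity.\<close>

definition infinity_chart :: "complex \<Rightarrow> riemann_sphere" where
  "infinity_chart w = (if w = 0 then None else Some (1 / w))"

text \<open>Analyticity on an open subset of the sphere, tested in the two standard charts.\<close>

definition sphere_analytic_on :: "(riemann_sphere \<Rightarrow> complex) \<Rightarrow> riemann_sphere set \<Rightarrow> bool" where
  "sphere_analytic_on f U \<longleftrightarrow>
     (\<lambda>z. f (Some z)) holomorphic_on {z. Some z \<in> U} \<and>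
     (\<lambda>w. f (infinity_chart w)) holomorphic_on {w. infinity_chart w \<in> U}"

definition H_infinity :: "riemann_sphere set \<Rightarrow> (riemann_sphere \<Rightarrow> complex) set" where
  "H_infinity U = {f. sphere_analytic_on f U \<and> bounded (f ` U)}"

definition sphere_compl :: "complex set \<Rightarrow> riemann_sphere set" where
  "sphere_compl E = UNIV - Some ` E"

definition deriv_at_infinity :: "(riemann_sphere \<Rightarrow> complex) \<Rightarrow> complex" where
  "deriv_at_infinity f = Lim at_infinity (\<lambda>z. z * (f (Some z) - f None))"

text \<open>Intended for compact \<^term>\<open>E\<close>: then the limits exist and the set below is bounded above
  (and it is nonempty, as it contains 0), so that the supremum over the reals is meaningful.\<close>

definition analytic_capacity :: "complex set \<Rightarrow> real" where
  "analytic_capacity E =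
     Sup {cmod (deriv_at_infinity f) | f.
            f \<in> H_infinity (sphere_compl E) \<and> (\<forall>p\<in>sphere_compl E. cmod (f p) \<le> 1)}"

definition disjoint_disk_union :: "real \<Rightarrow> complex set \<Rightarrow> bool" where
  "disjoint_disk_union r E \<longleftrightarrow>
     (\<exists>\<D>. finite \<D> \<and> (\<forall>D\<in>\<D>. \<exists>z0. D = cball z0 r) \<and> pairwise disjnt \<D> \<and> E = \<Union>\<D>)"

end

theory Submission
  imports Defs "HOL-Library.Diagonal_Subsequence"
begin

text \<open>Only the direction from disks to arbitrary compact sets \<open>E, F\<close> needs an argument. Let
  \<open>K = E \<union> F\<close>, let \<open>f\<close> be holomorphic and bounded by 1 off \<open>K\<close>, and multiply it by a Lipschitz
  cutoff that vanishes near \<open>K\<close> and is 1 at distance \<open>2 \<eta>\<close>; the product \<open>G\<close> is Lipschitz and still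
  bounded by 1. On a square grid of mesh \<open>s\<close> put
  \<open>h(z) = f(\<infinity>) + \<Sum>\<^sub>Q c\<^sub>Q / (z - z\<^sub>Q)\<close>, where \<open>z\<^sub>Q\<close> is the centre of the cell \<open>Q\<close> and
  \<open>2 \<pi> i c\<^sub>Q\<close> is the integral of \<open>G\<close> around \<open>Q\<close>. The edge integrals telescope, so
  \<open>h'(\<infinity>) = f'(\<infinity>)\<close> exactly, while the Lipschitz bound gives \<open>|G - h| = O(s log\<^sup>2 (1/s))\<close> outside
  the disks of radius \<open>s/3\<close> around the \<open>z\<^sub>Q\<close> close to \<open>K\<close>, the other \<open>c\<^sub>Q\<close> being 0.
  Hence these equal disjoint disks have capacity at least nearly \<open>|f'(\<infinity>)|\<close>. The disks close to \<open>E\<close>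
  and the remaining ones, which are close to \<open>F\<close>, have capacity at most slightly more than that of
  \<open>E\<close> and \<open>F\<close>, since analytic capacity is continuous along decreasing compact sets (Montel).\<close>

subsection \<open>Analytic capacity through functions on the plane\<close>

text \<open>The numbers \<open>c\<close> and \<open>a\<close> stand for the value and the derivative
  of \<open>f\<close> at infinity. Carrying them as parameters keeps the competitors on the plane,
  as total functions whose values on \<open>E\<close> are unconstrained.\<close>

definition admissible :: "complex set \<Rightarrow> (complex \<Rightarrow> complex) \<Rightarrow> complex \<Rightarrow> complex \<Rightarrow> bool" where
  "admissible E f c a \<longleftrightarrow> f holomorphic_on - E \<and> (\<forall>z\<in>- E. cmod (f z) \<le> 1) \<and>
     ((\<lambda>z. z * (f z - c)) \<longlongrightarrow> a) at_infinity"

text \<open>Under w = 1/z the product \<open>z * (f z - c)\<close> becomes the difference quotient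
  at 0 of \<open>f\<close> in the chart at infinity.\<close>

lemma tendsto_at_infinity_iff_chart_derivative:
  fixes f :: "complex \<Rightarrow> complex"
  shows "((\<lambda>z. z * (f z - c)) \<longlongrightarrow> a) at_infinity \<longleftrightarrow>
     ((\<lambda>w. if w = 0 then c else f (1 / w)) has_field_derivative a) (at 0)"
proof -
  have "((\<lambda>z. z * (f z - c)) \<longlongrightarrow> a) at_infinity \<longleftrightarrow>
      ((\<lambda>w. (f (1 / w) - c) / w) \<longlongrightarrow> a) (at 0)"
    unfolding lim_at_infinity_0 by (simp add: o_def divide_simps)
  also have "\<dots> \<longleftrightarrow> ((\<lambda>w. ((if w = 0 then c else f (1 / w)) - c) / w) \<longlongrightarrow> a) (at 0)"
    by (intro tendsto_cong eventually_mono[OF eventually_at_ball'[of 1]]) auto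
  finally show ?thesis unfolding DERIV_def by (simp cong: if_cong)
qed

lemma chart_field_differentiable:
  fixes f :: "complex \<Rightarrow> complex"
  assumes lim: "((\<lambda>z. z * (f z - c)) \<longlongrightarrow> a) at_infinity"
    and diff: "w \<noteq> 0 \<Longrightarrow> f field_differentiable (at (1 / w))"
  shows "(\<lambda>w. if w = 0 then c else f (1 / w)) field_differentiable (at w)"
proof (cases "w = 0")
  case True
  then show ?thesis
    using lim unfolding tendsto_at_infinity_iff_chart_derivative field_differentiable_def by auto
next
  case False
  then have "(f \<circ> (\<lambda>w. 1 / w)) field_differentiable (at w)"
    using diff by (intro field_differentiable_compose) (auto intro!: derivative_intros)
  then show ?thesis
  proof (rule field_differentiable_transform_within[of "cmod w", rotated 3])
    fix y assume "dist y w < cmod w"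
    then have "y \<noteq> 0" by auto
    then show "(f \<circ> (\<lambda>w. 1 / w)) y = (if y = 0 then c else f (1 / y))" by simp
  qed (use False in auto)
qed

lemma tendsto_const_at_infinity:
  fixes f :: "complex \<Rightarrow> complex"
  assumes "((\<lambda>z. z * (f z - c)) \<longlongrightarrow> a) at_infinity"
  shows "(f \<longlongrightarrow> c) at_infinity"
proof -
  have "((\<lambda>z. inverse z * (z * (f z - c)) + c) \<longlongrightarrow> 0 * a + c) at_infinity"
    by (intro tendsto_intros assms tendsto_inverse_0)
  moreover have "\<forall>\<^sub>F z in at_infinity. inverse z * (z * (f z - c)) + c = f z"
    using eventually_not_equal_at_infinity[of 0] by eventually_elim (simp flip: mult.assoc)
  ultimately show ?thesis by (simp add: tendsto_cong)
qed

lemma eventually_outside_compact: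
  assumes "compact (E :: complex set)"
  shows "eventually (\<lambda>z. z \<notin> E) at_infinity"
proof -
  obtain B where "\<And>z. z \<in> E \<Longrightarrow> cmod z \<le> B"
    using compact_imp_bounded[OF assms] bounded_iff by metis
  then show ?thesis unfolding eventually_at_infinity by (intro exI[of _ "B + 1"]) force
qed

text \<open>Restricting a function on the sphere to the finite points, and extending one on the
  plane by \<open>c\<close> at infinity, turn the two families of competitors into each other and
  preserve the derivative at infinity.\<close>

lemma analytic_capacity_eq:
  assumes "compact E"
  shows "analytic_capacity E = Sup {cmod a | f c a. admissible E f c a}"
proof -
  have "{cmod (deriv_at_infinity f) | f.
            f \<in> H_infinity (sphere_compl E) \<and> (\<forall>p\<in>sphere_compl E. cmod (f p) \<le> 1)} =
        {cmod a | f c a. admissible E f c a}" (is "?A = ?B")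
  proof (intro equalityI subsetI)
    fix x assume "x \<in> ?A"
    then obtain F where F: "sphere_analytic_on F (sphere_compl E)"
      "\<And>p. p \<in> sphere_compl E \<Longrightarrow> cmod (F p) \<le> 1" and x: "x = cmod (deriv_at_infinity F)"
      by (auto simp: H_infinity_def)
    define W where "W = {w. infinity_chart w \<in> sphere_compl E}"
    define g where "g = (\<lambda>w. F (infinity_chart w))"
    have "{z. Some z \<in> sphere_compl E} = - E" by (auto simp: sphere_compl_def)
    then have hol: "(\<lambda>z. F (Some z)) holomorphic_on - E"
      using F(1) by (simp add: sphere_analytic_on_def)
    have geq: "g = (\<lambda>w. if w = 0 then F None else F (Some (1 / w)))"
      by (auto simp: g_def infinity_chart_def)
    have "g holomorphic_on W"
      using F(1) by (simp add: sphere_analytic_on_def W_def g_def)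
    \<comment> \<open>As \<open>E\<close> is bounded, the chart domain contains a disk about 0. So
      \<open>g\<close> is differentiable there, and the \<open>Lim\<close> in
      \<open>deriv_at_infinity\<close> is a genuine limit.\<close>
    moreover have "\<exists>e>0. ball (0::complex) e \<subseteq> W"
    proof -
      obtain B where B: "\<And>z. z \<in> E \<Longrightarrow> cmod z \<le> B" "B > 0"
        using compact_imp_bounded[OF assms] bounded_pos by metis
      have "ball 0 (1 / B) \<subseteq> W"
      proof
        fix w :: complex assume w: "w \<in> ball 0 (1 / B)"
        then have "w \<noteq> 0 \<Longrightarrow> cmod (1 / w) > B" using B(2) by (simp add: norm_divide field_simps)
        then have "w \<noteq> 0 \<Longrightarrow> 1 / w \<notin> E" using B(1) by fastforce
        then show "w \<in> W" by (auto simp: W_def infinity_chart_def sphere_compl_def)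
      qed
      then show ?thesis using B(2) by (intro exI[of _ "1 / B"]) auto
    qed
    ultimately obtain e where "e > 0" "g holomorphic_on ball 0 e"
      using holomorphic_on_subset by blast
    then have "(g has_field_derivative deriv g 0) (at 0)"
      by (auto intro!: holomorphic_derivI)
    then have lim: "((\<lambda>z. z * (F (Some z) - F None)) \<longlongrightarrow> deriv g 0) at_infinity"
      by (simp add: tendsto_at_infinity_iff_chart_derivative geq)
    then have "deriv_at_infinity F = deriv g 0"
      unfolding deriv_at_infinity_def by (intro tendsto_Lim trivial_limit_at_infinity)
    moreover have "admissible E (\<lambda>z. F (Some z)) (F None) (deriv g 0)"
      using hol lim F(2) by (auto simp: admissible_def sphere_compl_def)
    ultimately show "x \<in> ?B" unfolding x mem_Collect_eq by (intro exI conjI[rotated]) auto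
  next
    fix x assume "x \<in> ?B"
    then obtain f c a where x: "x = cmod a" and hol: "f holomorphic_on - E"
      and bd: "\<And>z. z \<in> - E \<Longrightarrow> cmod (f z) \<le> 1"
      and lim: "((\<lambda>z. z * (f z - c)) \<longlongrightarrow> a) at_infinity"
      by (auto simp: admissible_def)
    define F where "F = (\<lambda>p. case p of None \<Rightarrow> c | Some z \<Rightarrow> f z)"
    define W where "W = {w. infinity_chart w \<in> sphere_compl E}"
    have [simp]: "F None = c" "\<And>z. F (Some z) = f z" by (auto simp: F_def)
    \<comment> \<open>Infinity belongs to the complement of \<open>E\<close> too, so the bound must
      be carried over to the limit.\<close>
    have c: "cmod c \<le> 1"
    proof (rule tendsto_upperbound[OF tendsto_norm[OF tendsto_const_at_infinity[OF lim]]])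
      show "\<forall>\<^sub>F z in at_infinity. cmod (f z) \<le> 1"
        using eventually_outside_compact[OF assms] by eventually_elim (use bd in auto)
    qed (rule trivial_limit_at_infinity)
    have "(\<lambda>w. F (infinity_chart w)) = (\<lambda>w. if w = 0 then c else f (1 / w))"
      by (auto simp: infinity_chart_def)
    moreover have "f field_differentiable (at (1 / w))" if "w \<in> W" "w \<noteq> 0" for w
    proof -
      have "1 / w \<in> - E"
        using that by (auto simp: W_def infinity_chart_def sphere_compl_def)
      then show ?thesis
        using hol assms holomorphic_on_imp_differentiable_at compact_imp_closed by blast
    qed
    ultimately have "(\<lambda>w. F (infinity_chart w)) field_differentiable (at w)" if "w \<in> W" for w
      using chart_field_differentiable[OF lim] that by simp
    then have "(\<lambda>w. F (infinity_chart w)) holomorphic_on W"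
      by (auto simp: holomorphic_on_def intro: field_differentiable_at_within)
    moreover have "{z. Some z \<in> sphere_compl E} = - E" by (auto simp: sphere_compl_def)
    ultimately have "sphere_analytic_on F (sphere_compl E)"
      using hol by (simp add: sphere_analytic_on_def W_def)
    moreover have bdF: "\<forall>p\<in>sphere_compl E. cmod (F p) \<le> 1"
      using bd c by (auto simp: sphere_compl_def F_def split: option.split)
    then have "bounded (F ` sphere_compl E)" by (auto simp: bounded_iff)
    moreover have "deriv_at_infinity F = a"
      unfolding deriv_at_infinity_def by (intro tendsto_Lim trivial_limit_at_infinity) (use lim in simp)
    ultimately show "x \<in> ?A" using x bdF by (auto simp: H_infinity_def)
  qed
  then show ?thesis by (simp add: analytic_capacity_def)
qed

section \<open>Cauchy estimates and expansions at infinity\<close>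

lemma holomorphic_chart:
  fixes f :: "complex \<Rightarrow> complex"
  assumes "f holomorphic_on - cball 0 \<rho>" "\<rho> > 0"
    and lim: "((\<lambda>z. z * (f z - c)) \<longlongrightarrow> a) at_infinity"
  shows "(\<lambda>w. if w = 0 then c else f (1 / w)) holomorphic_on ball 0 (1 / \<rho>)"
proof -
  have "f field_differentiable (at (1 / w))" if "w \<in> ball 0 (1 / \<rho>)" "w \<noteq> 0" for w
  proof -
    have "1 / w \<in> - cball 0 \<rho>" using that assms(2) by (auto simp: norm_divide field_simps)
    then show ?thesis using assms(1) holomorphic_on_imp_differentiable_at by blast
  qed
  then show ?thesis
    using chart_field_differentiable[OF lim] field_differentiable_at_within
    unfolding holomorphic_on_def by blast
qed

text \<open>Cauchy's inequality for the derivative at 0 in the chart 1/z, on the circle of radius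
  \<open>1 / R\<close>. Applied to a difference, it shows that uniform closeness on one circle
  forces the coefficients to be close.\<close>

lemma coefficient_bound:
  assumes hol: "f holomorphic_on - cball 0 \<rho>" and \<rho>: "\<rho> > 0" "R > \<rho>"
    and lim: "((\<lambda>z. z * (f z - c)) \<longlongrightarrow> a) at_infinity"
    and bd: "\<And>z. cmod z = R \<Longrightarrow> cmod (f z) \<le> M"
  shows "cmod a \<le> R * M"
proof -
  define g where "g = (\<lambda>w. if w = 0 then c else f (1 / w))"
  have g: "g holomorphic_on ball 0 (1 / \<rho>)"
    unfolding g_def by (rule holomorphic_chart) fact+
  have sub: "cball 0 (1 / R) \<subseteq> ball 0 (1 / \<rho>)"
    using \<rho> frac_less2[of 1 1 \<rho> R] by auto
  have "norm ((deriv ^^ 1) g 0) \<le> fact 1 * M / (1 / R) ^ 1"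
  proof (rule Cauchy_inequality)
    show "g holomorphic_on ball 0 (1 / R)"
      using g sub by (meson ball_subset_cball holomorphic_on_subset order_trans)
    show "continuous_on (cball 0 (1 / R)) g"
      using g sub holomorphic_on_imp_continuous_on continuous_on_subset by blast
    fix w :: complex assume "norm (0 - w) = 1 / R"
    then show "norm (g w) \<le> M"
      using \<rho> by (auto simp: g_def norm_divide intro!: bd)
  qed (use \<rho> in auto)
  moreover have "deriv g 0 = a"
    using lim unfolding tendsto_at_infinity_iff_chart_derivative g_def by (rule DERIV_imp_deriv)
  ultimately show ?thesis by (simp add: mult.commute)
qed

text \<open>By Riemann's theorem the bounded function \<open>f (1 / w)\<close> extends
  holomorphically over 0; \<open>c\<close> and \<open>a\<close> are the value and the derivative of
  the extension.\<close>

lemma expansion_at_infinity_exists: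
  assumes hol: "f holomorphic_on - E" and E: "compact E"
    and bd: "\<And>z. z \<in> - E \<Longrightarrow> cmod (f z) \<le> M"
  obtains c a where "((\<lambda>z. z * (f z - c)) \<longlongrightarrow> a) at_infinity"
proof -
  obtain B where B: "\<And>z. z \<in> E \<Longrightarrow> cmod z \<le> B" "B > 0"
    using compact_imp_bounded[OF E] bounded_pos by metis
  have inE: "1 / w \<in> - E" if "w \<in> ball 0 (1 / B) - {0}" for w :: complex
  proof -
    have "cmod (1 / w) > B" using that B(2) by (simp add: norm_divide field_simps)
    then show ?thesis using B(1) by fastforce
  qed
  have "(\<lambda>w. f (1 / w)) holomorphic_on ball 0 (1 / B) - {0}"
  proof -
    have "(f \<circ> (\<lambda>w. 1 / w)) holomorphic_on ball 0 (1 / B) - {0}"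
      using inE by (intro holomorphic_on_compose_gen[OF _ hol] holomorphic_intros) auto
    then show ?thesis by (simp add: o_def)
  qed
  moreover have "0 \<in> interior (ball (0::complex) (1 / B))" using B(2) by simp
  moreover have "\<forall>\<^sub>F w in at 0. cmod (f (1 / w)) \<le> M"
    unfolding eventually_at using B(2) inE bd by (intro exI[of _ "1 / B"]) (auto simp: dist_norm)
  ultimately obtain g where g: "g holomorphic_on ball 0 (1 / B)"
    "\<And>w. w \<in> ball 0 (1 / B) - {0} \<Longrightarrow> g w = f (1 / w)"
    using holomorphic_on_extend_bounded by blast
  have "(g has_field_derivative deriv g 0) (at 0)"
    using g(1) B(2) by (auto intro!: holomorphic_derivI)
  then have "((\<lambda>w. if w = 0 then g 0 else f (1 / w)) has_field_derivative deriv g 0) (at 0)"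
    by (rule has_field_derivative_transform_within_open[where S = "ball 0 (1 / B)"])
       (use B(2) g(2) in auto)
  then show ?thesis
    using that tendsto_at_infinity_iff_chart_derivative by blast
qed

text \<open>Cauchy's inequality on a circle enclosing \<open>E\<close>. Together with
  \<open>admissible_zero\<close> it makes the supremum a genuine one.\<close>

lemma admissible_values_bounded:
  assumes "compact E"
  shows "bdd_above {cmod a | f c a. admissible E f c a}"
proof -
  obtain B where B: "\<And>z. z \<in> E \<Longrightarrow> cmod z \<le> B" "B > 0"
    using compact_imp_bounded[OF assms] bounded_pos by metis
  have "cmod a \<le> (B + 1) * 1" if "admissible E f c a" for f c a
  proof (rule coefficient_bound[where \<rho> = B])
    show "f holomorphic_on - cball 0 B"
      using that B by (auto simp: admissible_def intro: holomorphic_on_subset)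
    show "((\<lambda>z. z * (f z - c)) \<longlongrightarrow> a) at_infinity"
      using that by (simp add: admissible_def)
    show "cmod (f z) \<le> 1" if "cmod z = B + 1" for z
      using \<open>admissible E f c a\<close> that B(1)[of z] by (auto simp: admissible_def)
  qed (use B in auto)
  then show ?thesis by (auto intro!: bdd_aboveI)
qed

section \<open>Elementary properties of analytic capacity\<close>

lemma admissible_zero: "admissible E (\<lambda>_. 0) 0 0"
  by (simp add: admissible_def)

lemma le_analytic_capacity:
  assumes "compact E" "admissible E f c a"
  shows "cmod a \<le> analytic_capacity E"
  unfolding analytic_capacity_eq[OF assms(1)]
  by (rule cSup_upper) (use assms admissible_values_bounded in auto)

lemma analytic_capacity_le:
  assumes "compact E" "\<And>f c a. admissible E f c a \<Longrightarrow> cmod a \<le> M"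
  shows "analytic_capacity E \<le> M"
  unfolding analytic_capacity_eq[OF assms(1)]
  by (rule cSup_least) (use assms(2) admissible_zero in blast)+

lemma analytic_capacity_nonneg:
  assumes "compact E"
  shows "0 \<le> analytic_capacity E"
  using le_analytic_capacity[OF assms admissible_zero] by simp

lemma admissible_mono:
  assumes "admissible E f c a" "E \<subseteq> F"
  shows "admissible F f c a"
  using assms by (auto simp: admissible_def intro: holomorphic_on_subset)

lemma analytic_capacity_mono:
  assumes "compact E" "compact F" "E \<subseteq> F"
  shows "analytic_capacity E \<le> analytic_capacity F"
  using assms by (intro analytic_capacity_le le_analytic_capacity) (auto intro: admissible_mono)

lemma le_analytic_capacity_scaled:
  assumes "compact E" "f holomorphic_on - E" "\<And>z. z \<in> - E \<Longrightarrow> cmod (f z) \<le> M" "M > 0"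
    "((\<lambda>z. z * (f z - c)) \<longlongrightarrow> a) at_infinity"
  shows "cmod a \<le> M * analytic_capacity E"
proof -
  have "((\<lambda>z. z * (f z - c) / of_real M) \<longlongrightarrow> a / of_real M) at_infinity"
    by (intro tendsto_intros assms) (use assms in auto)
  then have "((\<lambda>z. z * (f z / of_real M - c / of_real M)) \<longlongrightarrow> a / of_real M) at_infinity"
    by (simp add: diff_divide_distrib right_diff_distrib)
  then have "admissible E (\<lambda>z. f z / of_real M) (c / of_real M) (a / of_real M)"
    using assms by (auto simp: admissible_def norm_divide intro!: holomorphic_intros)
  from le_analytic_capacity[OF assms(1) this] show ?thesis
    using assms(4) by (simp add: norm_divide field_simps)
qed

subsection \<open>Outer regularity\<close>

text \<open>On a fixed \<open>U n\<close> all but finitely many members of the sequence are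
  holomorphic and bounded by \<open>M\<close>, so Montel's theorem applies there; a diagonal
  subsequence serves all \<open>n\<close> at once.\<close>

lemma Montel_increasing:
  fixes U :: "nat \<Rightarrow> complex set" and f :: "nat \<Rightarrow> complex \<Rightarrow> complex"
  assumes op: "\<And>n. open (U n)" and inc: "incseq U"
    and hol: "\<And>n. f n holomorphic_on U n" and bd: "\<And>n z. z \<in> U n \<Longrightarrow> cmod (f n z) \<le> M"
  obtains g r where "strict_mono r" "g holomorphic_on (\<Union>n. U n)"
    "\<And>K. compact K \<Longrightarrow> K \<subseteq> (\<Union>n. U n) \<Longrightarrow> uniform_limit K (f \<circ> r) g sequentially"
proof -
  \<comment> \<open>Locally uniform convergence on \<open>U n\<close> along \<open>s\<close>. The
    diagonal construction requires that this survives passage to subsequences, which is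
    \<open>Pr\<close>.\<close>
  define P where "P n s \<longleftrightarrow> (\<exists>g. g holomorphic_on U n \<and>
      (\<forall>K. compact K \<longrightarrow> K \<subseteq> U n \<longrightarrow> uniform_limit K (f \<circ> s) g sequentially))"
    for n and s :: "nat \<Rightarrow> nat"
  have PD: "\<exists>g. g holomorphic_on U n \<and>
      (\<forall>K. compact K \<longrightarrow> K \<subseteq> U n \<longrightarrow> uniform_limit K (f \<circ> s) g sequentially)"
    if "P n s" for n s
    using that by (simp only: P_def)
  have Pr: "P n (s \<circ> r)" if "strict_mono r" "P n s" for r s n
  proof -
    have "uniform_limit K (f \<circ> (s \<circ> r)) g sequentially"
      if "uniform_limit K (f \<circ> s) g sequentially" for K g
      using filterlim_compose[OF that filterlim_subseq[OF \<open>strict_mono r\<close>]] by (simp add: o_def)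
    then show ?thesis using that(2) unfolding P_def by blast
  qed
  interpret subseqs P
  proof
    fix n and s :: "nat \<Rightarrow> nat" assume s: "strict_mono s"
    \<comment> \<open>The shift by \<open>n\<close> ensures \<open>s (k + n) \<ge> n\<close>, so
      that the whole family is holomorphic on \<open>U n\<close>.\<close>
    define \<F> where "\<F> k = f (s (k + n))" for k
    have sub: "U n \<subseteq> U (s (k + n))" for k
      using incseqD[OF inc, of n "s (k + n)"] seq_suble[OF s, of "k + n"] by simp
    have "\<And>h. h \<in> range \<F> \<Longrightarrow> h holomorphic_on U n"
      unfolding \<F>_def using hol sub holomorphic_on_subset by blast
    moreover have "\<exists>B. \<forall>h\<in>range \<F>. \<forall>z\<in>K. cmod (h z) \<le> B" if "K \<subseteq> U n" for K
      unfolding \<F>_def using bd sub that by blast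
    ultimately obtain g r where g: "g holomorphic_on U n" "strict_mono (r :: nat \<Rightarrow> nat)"
      "\<And>K. \<lbrakk>compact K; K \<subseteq> U n\<rbrakk> \<Longrightarrow> uniform_limit K (\<F> \<circ> r) g sequentially"
      by (rule Montel[OF op[of n], of "range \<F>" \<F>]) auto
    have "strict_mono (\<lambda>k. r k + n)" using g(2) by (simp add: strict_mono_def)
    moreover have "f \<circ> (s \<circ> (\<lambda>k. r k + n)) = \<F> \<circ> r" by (auto simp: \<F>_def)
    ultimately show "\<exists>r'. strict_mono r' \<and> P n (s \<circ> r')"
      unfolding P_def using g(1,3) by (intro exI[of _ "\<lambda>k. r k + n"] exI[of _ g] conjI) auto
  qed
  \<comment> \<open>From index \<open>Suc k\<close> on, the diagonal sequence is a subsequence of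
    the one selected for \<open>P k\<close>.\<close>
  have "P k (diagseq \<circ> ((+) (Suc k)))" for k
    by (intro diagseq_holds) (use Pr in auto)
  then have "\<forall>k. \<exists>g. g holomorphic_on U k \<and> (\<forall>K. compact K \<longrightarrow> K \<subseteq> U k \<longrightarrow>
      uniform_limit K (f \<circ> (diagseq \<circ> ((+) (Suc k)))) g sequentially)"
    by (blast intro: PD)
  from choice[OF this] obtain G where G: "\<And>k. G k holomorphic_on U k"
    "\<And>k K. compact K \<Longrightarrow> K \<subseteq> U k \<Longrightarrow>
       uniform_limit K (f \<circ> (diagseq \<circ> ((+) (Suc k)))) (G k) sequentially"
    by blast
  have unif: "uniform_limit K (f \<circ> diagseq) (G k) sequentially" if "compact K" "K \<subseteq> U k" for k K
  proof -
    have "uniform_limit K (\<lambda>n. (f \<circ> diagseq) (n + Suc k)) (G k) sequentially"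
      using G(2)[OF that] by (simp add: o_def add.commute)
    then show ?thesis
      unfolding uniform_limit_iff
      by (subst (asm) eventually_sequentially_seg[where P = "\<lambda>n. \<forall>z\<in>K. dist ((f \<circ> diagseq) n z) (G k z) < _"])
  qed
  \<comment> \<open>Each \<open>G k\<close> is the pointwise limit of the same diagonal sequence on
    \<open>U k\<close>, so the pointwise limit glues them together.\<close>
  define g where "g z = lim (\<lambda>n. f (diagseq n) z)" for z
  have geq: "g z = G k z" if "z \<in> U k" for z k
  proof -
    have "(\<lambda>n. (f \<circ> diagseq) n z) \<longlonglongrightarrow> G k z"
      by (rule tendsto_uniform_limitI[OF unif[of "{z}" k]]) (use that in auto)
    then show ?thesis by (simp add: g_def limI)
  qed
  show ?thesis
  proof (rule that[of diagseq g])
    show "strict_mono diagseq" by (rule subseq_diagseq)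
    have "g holomorphic_on U k" for k
      using G(1) geq holomorphic_cong by blast
    then show "g holomorphic_on (\<Union>n. U n)"
      by (intro holomorphic_on_UN_open) (use op in auto)
    fix K assume K: "compact K" "K \<subseteq> (\<Union>n. U n)"
    obtain k where "K \<subseteq> U k"
    proof -
      obtain T where T: "finite T" "K \<subseteq> (\<Union>n\<in>T. U n)"
        using compactE_image[OF K(1), of UNIV U] op K(2) by metis
      \<comment> \<open>The sets form a chain, so the largest index of a finite subcover suffices;
        \<open>insert 0\<close> covers the case of an empty subcover.\<close>
      have "K \<subseteq> U (Max (insert 0 T))"
      proof
        fix z assume "z \<in> K"
        then obtain n where "n \<in> T" "z \<in> U n" using T by auto
        then show "z \<in> U (Max (insert 0 T))"
          using incseqD[OF inc, of n "Max (insert 0 T)"] T(1) by auto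
      qed
      then show ?thesis using that by blast
    qed
    then show "uniform_limit K (f \<circ> diagseq) g sequentially"
    proof -
      assume k: "K \<subseteq> U k"
      then have "uniform_limit K (f \<circ> diagseq) g sequentially \<longleftrightarrow>
          uniform_limit K (f \<circ> diagseq) (G k) sequentially"
        using geq by (intro uniform_limit_cong') auto
      then show ?thesis using unif[OF K(1) k] by simp
    qed
  qed
qed

text \<open>Otherwise shrinking neighbourhoods would carry admissible functions with coefficients
  above \<open>analytic_capacity E + \<epsilon>\<close>. By Montel a subsequence converges off
  \<open>E\<close> to a function bounded by 1, and convergence on a circle brings some coefficient
  within \<epsilon> of that of the limit.\<close>

lemma analytic_capacity_outer_regular:
  assumes E: "compact E" and "\<epsilon> > 0"
  obtains \<delta> where "\<delta> > 0" "analytic_capacity (\<Union>x\<in>E. cball x \<delta>) \<le> analytic_capacity E + \<epsilon>"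
proof (rule ccontr)
  assume no: "\<not> thesis"
  define \<delta> :: "nat \<Rightarrow> real" where "\<delta> n = inverse (real (Suc n))" for n
  define En where "En n = (\<Union>x\<in>E. cball x (\<delta> n))" for n
  have comp: "compact (En n)" for n
    unfolding En_def using E by (rule compact_minkowski_sum_cball)
  have "\<exists>f c a. admissible (En n) f c a \<and> cmod a > analytic_capacity E + \<epsilon>" for n
  proof (rule ccontr)
    assume "\<not> ?thesis"
    then have "analytic_capacity (En n) \<le> analytic_capacity E + \<epsilon>"
      by (intro analytic_capacity_le comp) (meson not_le)
    then show False using no that[of "\<delta> n"] by (simp add: En_def \<delta>_def)
  qed
  then obtain f c a where f: "\<And>n. admissible (En n) (f n) (c n) (a n)"
    and a: "\<And>n. cmod (a n) > analytic_capacity E + \<epsilon>" by metis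
  have U: "(\<Union>n. - En n) = - E"
  proof -
    have "z \<in> E" if "\<And>n. z \<in> En n" for z
    proof (rule ccontr)
      assume "z \<notin> E"
      then obtain e where e: "e > 0" "ball z e \<subseteq> - E"
        using open_contains_ball[of "- E"] compact_imp_closed[OF E] by blast
      obtain n where n: "\<delta> n < e" using reals_Archimedean[OF e(1)] by (auto simp: \<delta>_def)
      have "z \<in> En n" by (rule that)
      then obtain x where "x \<in> E" "dist x z \<le> \<delta> n" by (auto simp: En_def)
      then show False using e(2) n by (auto simp: dist_commute subset_eq)
    qed
    moreover have "E \<subseteq> En n" for n by (force simp: En_def \<delta>_def)
    ultimately show ?thesis by blast
  qed
  have inc: "incseq (\<lambda>n. - En n)"
  proof (rule monoI)
    fix m n :: nat assume "m \<le> n"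
    then have "\<delta> n \<le> \<delta> m" by (simp add: \<delta>_def)
    then have "En n \<subseteq> En m" by (force simp: En_def)
    then show "- En m \<le> - En n" by auto
  qed
  obtain g r where r: "strict_mono r" and g: "g holomorphic_on - E"
    and unif: "\<And>K. compact K \<Longrightarrow> K \<subseteq> - E \<Longrightarrow> uniform_limit K (f \<circ> r) g sequentially"
  proof (rule Montel_increasing[of "\<lambda>n. - En n" f 1])
    show "open (- En n)" for n using comp compact_imp_closed by blast
    show "f n holomorphic_on - En n" "z \<in> - En n \<Longrightarrow> cmod (f n z) \<le> 1" for n z
      using f[of n] by (auto simp: admissible_def)
  qed (use inc U in auto)
  have g1: "cmod (g z) \<le> 1" if "z \<in> - E" for z
  proof (rule tendsto_upperbound)
    show "(\<lambda>n. cmod ((f \<circ> r) n z)) \<longlonglongrightarrow> cmod (g z)"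
      by (intro tendsto_norm tendsto_uniform_limitI[OF unif[of "{z}"]]) (use that in auto)
    have "z \<in> (\<Union>n. - En n)" unfolding U by (rule that)
    then obtain n0 where n0: "z \<in> - En n0" by (rule UN_E)
    have "cmod ((f \<circ> r) n z) \<le> 1" if "n \<ge> n0" for n
    proof -
      have "n0 \<le> r n" using that seq_suble[OF r, of n] by simp
      then have "z \<in> - En (r n)" using incseqD[OF inc] n0 by blast
      then show ?thesis using f[of "r n"] by (auto simp: admissible_def)
    qed
    then show "\<forall>\<^sub>F n in sequentially. cmod ((f \<circ> r) n z) \<le> 1"
      by (rule eventually_sequentiallyI)
  qed auto
  obtain cg ag where lim: "((\<lambda>z. z * (g z - cg)) \<longlongrightarrow> ag) at_infinity"
    using expansion_at_infinity_exists[OF g E g1] by blast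
  then have ag: "cmod ag \<le> analytic_capacity E"
    using g g1 by (intro le_analytic_capacity[OF E, of g cg]) (auto simp: admissible_def)
  obtain B where B: "\<And>z. z \<in> E \<Longrightarrow> cmod z \<le> B" "B > 0"
    using compact_imp_bounded[OF E] bounded_pos by metis
  \<comment> \<open>Since \<open>\<delta> n \<le> 1\<close>, every \<open>En n\<close> lies in the
    disk of radius \<open>B + 1\<close>, inside this circle. The tolerance
    \<open>\<epsilon> / R\<close> below makes up for the factor \<open>R\<close> in
    \<open>coefficient_bound\<close>.\<close>
  define R where "R = B + 2"
  have "sphere 0 R \<subseteq> - E" using B by (force simp: R_def)
  then have "uniform_limit (sphere 0 R) (f \<circ> r) g sequentially" by (intro unif) auto
  moreover have "\<epsilon> / R > 0" using assms(2) B by (simp add: R_def)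
  ultimately have "\<forall>\<^sub>F n in sequentially. \<forall>z\<in>sphere 0 R. dist ((f \<circ> r) n z) (g z) < \<epsilon> / R"
    by (rule uniform_limitD)
  then obtain n where n: "\<And>z. cmod z = R \<Longrightarrow> cmod (f (r n) z - g z) < \<epsilon> / R"
    using eventually_happens'[OF sequentially_bot] by (force simp: dist_norm)
  have "cmod (a (r n) - ag) \<le> R * (\<epsilon> / R)"
  proof (rule coefficient_bound[where \<rho> = "B + 1"])
    have "En (r n) \<subseteq> cball 0 (B + 1)"
    proof
      fix z assume "z \<in> En (r n)"
      then obtain x where x: "x \<in> E" "dist x z \<le> \<delta> (r n)" by (auto simp: En_def)
      have "\<delta> (r n) \<le> 1" by (simp add: \<delta>_def field_simps)
      then have "cmod z \<le> B + 1"
        using x B(1)[of x] norm_triangle_ineq2[of z x] by (simp add: dist_norm norm_minus_commute)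
      then show "z \<in> cball 0 (B + 1)" by simp
    qed
    then have "f (r n) holomorphic_on - cball 0 (B + 1)"
      using f[of "r n"] by (auto simp: admissible_def intro: holomorphic_on_subset)
    moreover have "g holomorphic_on - cball 0 (B + 1)"
      using g B by (force intro: holomorphic_on_subset)
    ultimately show "(\<lambda>z. f (r n) z - g z) holomorphic_on - cball 0 (B + 1)"
      by (intro holomorphic_intros)
    have "((\<lambda>z. z * (f (r n) z - c (r n)) - z * (g z - cg)) \<longlongrightarrow> a (r n) - ag) at_infinity"
      using f[of "r n"] lim by (intro tendsto_diff) (auto simp: admissible_def)
    then show "((\<lambda>z. z * ((f (r n) z - g z) - (c (r n) - cg))) \<longlongrightarrow> a (r n) - ag) at_infinity"
      by (simp add: algebra_simps)
    show "cmod (f (r n) z - g z) \<le> \<epsilon> / R" if "cmod z = R" for z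
      using n[OF that] by simp
  qed (use B in \<open>auto simp: R_def\<close>)
  then have "cmod (a (r n) - ag) \<le> \<epsilon>" using B by (simp add: R_def)
  then show False
    using a[of "r n"] ag norm_triangle_ineq2[of "a (r n)" ag] by linarith
qed

subsection \<open>Contour integrals along a square grid\<close>

locale square_grid =
  fixes s :: real
  assumes s_pos: "s > 0"
begin

definition corner :: "int \<Rightarrow> int \<Rightarrow> complex" where
  "corner k l = Complex (of_int k * s) (of_int l * s)"

definition centre :: "int \<Rightarrow> int \<Rightarrow> complex" where
  "centre k l = Complex ((of_int k + 1 / 2) * s) ((of_int l + 1 / 2) * s)"

definition rect :: "int \<Rightarrow> int \<Rightarrow> int \<Rightarrow> int \<Rightarrow> complex set" where
  "rect m m' n n' = cbox (corner m n) (corner m' n')"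

definition rim :: "int \<Rightarrow> int \<Rightarrow> int \<Rightarrow> int \<Rightarrow> complex set" where
  "rim m m' n n' = cbox (corner m n) (corner m' n') - box (corner m n) (corner m' n')"

definition h_integral :: "(complex \<Rightarrow> complex) \<Rightarrow> int \<Rightarrow> int \<Rightarrow> int \<Rightarrow> complex" where
  "h_integral \<phi> m m' l = contour_integral (linepath (corner m l) (corner m' l)) \<phi>"

definition v_integral :: "(complex \<Rightarrow> complex) \<Rightarrow> int \<Rightarrow> int \<Rightarrow> int \<Rightarrow> complex" where
  "v_integral \<phi> k n n' = contour_integral (linepath (corner k n) (corner k n')) \<phi>"

text \<open>The counterclockwise boundary integral, with all edges directed to the right or upwards,
  so that an edge shared by two cells contributes literally the same term with opposite
  signs.\<close>

definition rect_integral ::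
    "(complex \<Rightarrow> complex) \<Rightarrow> int \<Rightarrow> int \<Rightarrow> int \<Rightarrow> int \<Rightarrow> complex" where
  "rect_integral \<phi> m m' n n' =
     h_integral \<phi> m m' n + v_integral \<phi> m' n n' - h_integral \<phi> m m' n' - v_integral \<phi> m n n'"

abbreviation cell :: "int \<Rightarrow> int \<Rightarrow> complex set" where
  "cell k l \<equiv> rect k (k + 1) l (l + 1)"

abbreviation cell_integral :: "(complex \<Rightarrow> complex) \<Rightarrow> int \<Rightarrow> int \<Rightarrow> complex" where
  "cell_integral \<phi> k l \<equiv> rect_integral \<phi> k (k + 1) l (l + 1)"

lemma corner_simps [simp]: "Re (corner k l) = of_int k * s" "Im (corner k l) = of_int l * s"
  by (simp_all add: corner_def)

lemma centre_simps [simp]: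
  "Re (centre k l) = (of_int k + 1 / 2) * s" "Im (centre k l) = (of_int l + 1 / 2) * s"
  by (simp_all add: centre_def)

lemma mem_rect:
  "z \<in> rect m m' n n' \<longleftrightarrow>
     of_int m * s \<le> Re z \<and> Re z \<le> of_int m' * s \<and> of_int n * s \<le> Im z \<and> Im z \<le> of_int n' * s"
  by (auto simp: rect_def in_cbox_complex_iff)

lemma mem_rim:
  "z \<in> rim m m' n n' \<longleftrightarrow> z \<in> rect m m' n n' \<and>
     (Re z = of_int m * s \<or> Re z = of_int m' * s \<or> Im z = of_int n * s \<or> Im z = of_int n' * s)"
  by (auto simp: rim_def rect_def in_cbox_complex_iff in_box_complex_iff)

lemma rim_subset_rect: "rim m m' n n' \<subseteq> rect m m' n n'"
  by (auto simp: mem_rim)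

lemma segment_subset_rim:
  assumes "m \<le> m'" "n \<le> n'"
  shows "closed_segment (corner m n) (corner m' n) \<subseteq> rim m m' n n'"
    "closed_segment (corner m n') (corner m' n') \<subseteq> rim m m' n n'"
    "closed_segment (corner m n) (corner m n') \<subseteq> rim m m' n n'"
    "closed_segment (corner m' n) (corner m' n') \<subseteq> rim m m' n n'"
  using assms s_pos
  by (auto simp: mem_rim mem_rect closed_segment_same_Re closed_segment_same_Im
      closed_segment_eq_real_ivl)

lemma h_integral_eq_sum:
  assumes "m \<le> m'" "continuous_on (closed_segment (corner m l) (corner m' l)) \<phi>"
  shows "h_integral \<phi> m m' l = (\<Sum>k\<in>{m..<m'}. h_integral \<phi> k (k + 1) l)"
  using assms
proof (induction m' rule: int_ge_induct)
  case base
  then show ?case by (simp add: h_integral_def)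
next
  case (step i)
  have sub: "corner i l \<in> closed_segment (corner m l) (corner (i + 1) l)"
    using step(1) s_pos
    by (auto simp: closed_segment_same_Im closed_segment_eq_real_ivl)
  have "h_integral \<phi> m (i + 1) l = h_integral \<phi> m i l + h_integral \<phi> i (i + 1) l"
    unfolding h_integral_def by (rule contour_integral_split_linepath) (use step sub in auto)
  moreover have "continuous_on (closed_segment (corner m l) (corner i l)) \<phi>"
    by (rule continuous_on_subset[OF step(3)]) (use sub in \<open>simp add: subset_closed_segment\<close>)
  moreover have "{m..<i + 1} = insert i {m..<i}" using step(1) by auto
  ultimately show ?case using step.IH by simp
qed

lemma v_integral_eq_sum:
  assumes "n \<le> n'" "continuous_on (closed_segment (corner k n) (corner k n')) \<phi>"
  shows "v_integral \<phi> k n n' = (\<Sum>l\<in>{n..<n'}. v_integral \<phi> k l (l + 1))"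
  using assms
proof (induction n' rule: int_ge_induct)
  case base
  then show ?case by (simp add: v_integral_def)
next
  case (step i)
  have sub: "corner k i \<in> closed_segment (corner k n) (corner k (i + 1))"
    using step(1) s_pos
    by (auto simp: closed_segment_same_Re closed_segment_eq_real_ivl)
  have "v_integral \<phi> k n (i + 1) = v_integral \<phi> k n i + v_integral \<phi> k i (i + 1)"
    unfolding v_integral_def by (rule contour_integral_split_linepath) (use step sub in auto)
  moreover have "continuous_on (closed_segment (corner k n) (corner k i)) \<phi>"
    by (rule continuous_on_subset[OF step(3)]) (use sub in \<open>simp add: subset_closed_segment\<close>)
  moreover have "{n..<i + 1} = insert i {n..<i}" using step(1) by auto
  ultimately show ?case using step.IH by simp
qed

lemma sum_int_telescope:
  fixes f :: "int \<Rightarrow> 'b :: ab_group_add"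
  assumes "m \<le> n"
  shows "(\<Sum>k\<in>{m..<n}. f k - f (k + 1)) = f m - f n"
  using assms
proof (induction n rule: int_ge_induct)
  case (step i)
  have "{m..<i + 1} = insert i {m..<i}" using step(1) by auto
  then show ?case using step by (simp add: algebra_simps)
qed auto

text \<open>Inner edges cancel formally, so the integrand may be singular off the rim: integrals over such
  edges are junk values that occur twice with opposite signs.\<close>

lemma sum_cell_integral:
  assumes "m \<le> m'" "n \<le> n'" "continuous_on (rim m m' n n') \<phi>"
  shows "(\<Sum>k\<in>{m..<m'}. \<Sum>l\<in>{n..<n'}. cell_integral \<phi> k l) = rect_integral \<phi> m m' n n'"
proof -
  have "(\<Sum>k\<in>{m..<m'}. \<Sum>l\<in>{n..<n'}. cell_integral \<phi> k l) =
     (\<Sum>k\<in>{m..<m'}. \<Sum>l\<in>{n..<n'}. h_integral \<phi> k (k + 1) l - h_integral \<phi> k (k + 1) (l + 1)) -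
     (\<Sum>k\<in>{m..<m'}. \<Sum>l\<in>{n..<n'}. v_integral \<phi> k l (l + 1) - v_integral \<phi> (k + 1) l (l + 1))"
    by (simp add: rect_integral_def algebra_simps flip: sum_subtractf sum.distrib)
  also have "(\<Sum>k\<in>{m..<m'}. \<Sum>l\<in>{n..<n'}. h_integral \<phi> k (k + 1) l - h_integral \<phi> k (k + 1) (l + 1)) =
     (\<Sum>k\<in>{m..<m'}. h_integral \<phi> k (k + 1) n) - (\<Sum>k\<in>{m..<m'}. h_integral \<phi> k (k + 1) n')"
    using sum_int_telescope[OF assms(2), of "\<lambda>l. h_integral \<phi> _ (_ + 1) l"]
    by (simp add: sum_subtractf)
  also have "(\<Sum>k\<in>{m..<m'}. \<Sum>l\<in>{n..<n'}. v_integral \<phi> k l (l + 1) - v_integral \<phi> (k + 1) l (l + 1)) =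
     (\<Sum>l\<in>{n..<n'}. v_integral \<phi> m l (l + 1)) - (\<Sum>l\<in>{n..<n'}. v_integral \<phi> m' l (l + 1))"
    using sum_int_telescope[OF assms(1), of "\<lambda>k. v_integral \<phi> k _ (_ + 1)"]
    by (subst sum.swap) (simp add: sum_subtractf)
  finally show ?thesis
    using segment_subset_rim[OF assms(1,2)] assms continuous_on_subset[OF assms(3)]
    by (simp add: rect_integral_def h_integral_eq_sum v_integral_eq_sum)
qed

section \<open>Linearity, size and residues of rectangle integrals\<close>

lemma rect_integral_add:
  assumes "m \<le> m'" "n \<le> n'" "continuous_on (rim m m' n n') \<phi>" "continuous_on (rim m m' n n') \<psi>"
  shows "rect_integral (\<lambda>z. \<phi> z + \<psi> z) m m' n n' =
    rect_integral \<phi> m m' n n' + rect_integral \<psi> m m' n n'"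
  using segment_subset_rim[OF assms(1,2)]
    continuous_on_subset[OF assms(3)] continuous_on_subset[OF assms(4)]
  by (simp add: rect_integral_def h_integral_def v_integral_def contour_integral_add
      contour_integrable_continuous_linepath)

lemma rect_integral_cmult:
  assumes "m \<le> m'" "n \<le> n'" "continuous_on (rim m m' n n') \<phi>"
  shows "rect_integral (\<lambda>z. b * \<phi> z) m m' n n' = b * rect_integral \<phi> m m' n n'"
  using segment_subset_rim[OF assms(1,2)] continuous_on_subset[OF assms(3)]
  by (simp add: rect_integral_def h_integral_def v_integral_def contour_integral_lmul
      contour_integrable_continuous_linepath algebra_simps)

lemma rect_integral_bound:
  assumes "m \<le> m'" "n \<le> n'" "continuous_on (rim m m' n n') \<phi>" "B \<ge> 0"
    "\<And>z. z \<in> rim m m' n n' \<Longrightarrow> cmod (\<phi> z) \<le> B"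
  shows "cmod (rect_integral \<phi> m m' n n') \<le> B * (2 * (of_int (m' - m) + of_int (n' - n)) * s)"
proof -
  have int: "\<phi> contour_integrable_on linepath a b" if "closed_segment a b \<subseteq> rim m m' n n'" for a b
    using that by (rule contour_integrable_continuous_linepath[OF continuous_on_subset[OF assms(3)]])
  have bd: "cmod (contour_integral (linepath a b) \<phi>) \<le> B * cmod (b - a)"
    if "closed_segment a b \<subseteq> rim m m' n n'" for a b
    using that assms(4,5) int by (intro contour_integral_bound_linepath) auto
  have h: "cmod (corner m' l - corner m l) = of_int (m' - m) * s" for l
    using assms(1) s_pos by (simp add: cmod_eq_Re flip: left_diff_distrib)
  have v: "cmod (corner k n' - corner k n) = of_int (n' - n) * s" for k
    using assms(2) s_pos by (simp add: cmod_eq_Im flip: left_diff_distrib)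
  have tri: "cmod (a + b - c - d) \<le> cmod a + cmod b + cmod c + cmod d" for a b c d
    using norm_triangle_ineq4[of "a + b - c" d] norm_triangle_ineq4[of "a + b" c]
      norm_triangle_ineq[of a b] by linarith
  note seg = segment_subset_rim[OF assms(1,2)]
  have "cmod (rect_integral \<phi> m m' n n') \<le>
     cmod (h_integral \<phi> m m' n) + cmod (v_integral \<phi> m' n n') +
     cmod (h_integral \<phi> m m' n') + cmod (v_integral \<phi> m n n')"
    unfolding rect_integral_def by (rule tri)
  also have "\<dots> \<le> B * (of_int (m' - m) * s) + B * (of_int (n' - n) * s) +
      B * (of_int (m' - m) * s) + B * (of_int (n' - n) * s)"
    using bd[OF seg(1)] bd[OF seg(2)] bd[OF seg(3)] bd[OF seg(4)]
    unfolding h_integral_def v_integral_def h v by linarith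
  finally show ?thesis by (simp add: algebra_simps)
qed

text \<open>The link to Cauchy's theorem and winding numbers. \<open>rectpath\<close> traverses the
  top and left edges backwards, which accounts for the two minus signs.\<close>

lemma contour_integral_rectpath_eq:
  assumes "m \<le> m'" "n \<le> n'" "continuous_on (rim m m' n n') \<phi>"
  shows "contour_integral (rectpath (corner m n) (corner m' n')) \<phi> = rect_integral \<phi> m m' n n'"
proof -
  have int: "\<phi> contour_integrable_on linepath a b" if "closed_segment a b \<subseteq> rim m m' n n'" for a b
    using that by (rule contour_integrable_continuous_linepath[OF continuous_on_subset[OF assms(3)]])
  note seg = segment_subset_rim[OF assms(1,2)]
  note int4 = int[OF seg(1)] int[OF seg(2)] int[OF seg(3)] int[OF seg(4)]
  have int2: "\<phi> contour_integrable_on linepath (corner m' n') (corner m n')"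
    "\<phi> contour_integrable_on linepath (corner m n') (corner m n)"
    using seg(2,3) by (auto intro!: int simp: closed_segment_commute)
  have c: "Complex (of_int m' * s) (of_int n * s) = corner m' n"
    "Complex (of_int m * s) (of_int n' * s) = corner m n'" by (simp_all add: corner_def)
  have r: "contour_integral (linepath (corner m' n') (corner m n')) \<phi> = - h_integral \<phi> m m' n'"
    "contour_integral (linepath (corner m n') (corner m n)) \<phi> = - v_integral \<phi> m n n'"
    unfolding h_integral_def v_integral_def
    by (intro contour_integral_reverse_linepath continuous_on_subset[OF assms(3)];
        use seg in \<open>simp add: closed_segment_commute\<close>)+
  show ?thesis
    using int4 int2
    by (simp add: rectpath_def Let_def c r[unfolded h_integral_def v_integral_def]
        rect_integral_def h_integral_def v_integral_def)
qed

lemma rim_eq_path_image: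
  assumes "m \<le> m'" "n \<le> n'"
  shows "rim m m' n n' = path_image (rectpath (corner m n) (corner m' n'))"
  using assms s_pos by (simp add: rim_def path_image_rectpath_cbox_minus_box)

lemma rect_integral_holomorphic:
  assumes "m \<le> m'" "n \<le> n'" "\<phi> holomorphic_on rect m m' n n'"
  shows "rect_integral \<phi> m m' n n' = 0"
proof -
  have "(\<phi> has_contour_integral 0) (rectpath (corner m n) (corner m' n'))"
    using rim_subset_rect[of m m' n n'] rim_eq_path_image[OF assms(1,2)]
    by (intro Cauchy_theorem_convex_simple[OF assms(3)]) (auto simp: rect_def)
  moreover have "continuous_on (rim m m' n n') \<phi>"
    using assms(3) rim_subset_rect holomorphic_on_imp_continuous_on continuous_on_subset by blast
  ultimately show ?thesis
    using contour_integral_rectpath_eq[OF assms(1,2)] contour_integral_unique by metis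
qed

lemma rect_integral_inverse:
  assumes "m < 0" "0 < m'" "n < 0" "0 < n'"
  shows "rect_integral (\<lambda>z. 1 / z) m m' n n' = 2 * of_real pi * \<i>"
proof -
  let ?\<gamma> = "rectpath (corner m n) (corner m' n')"
  have box: "0 \<in> box (corner m n) (corner m' n')"
    using assms s_pos by (simp add: in_box_complex_iff mult_neg_pos)
  then have 0: "0 \<notin> rim m m' n n'" by (simp add: rim_def)
  then have "1 = 1 / (2 * of_real pi * \<i>) * contour_integral ?\<gamma> (\<lambda>w. 1 / (w - 0))"
    using winding_number_valid_path[of ?\<gamma> 0] winding_number_rectpath[OF box] rim_eq_path_image assms
    by simp
  moreover have "continuous_on (rim m m' n n') (\<lambda>z. 1 / z)"
    using 0 by (auto intro!: continuous_intros)
  then have "contour_integral ?\<gamma> (\<lambda>w. 1 / w) = rect_integral (\<lambda>z. 1 / z) m m' n n'"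
    using assms by (intro contour_integral_rectpath_eq) auto
  ultimately show ?thesis by (simp add: field_simps)
qed

lemma cmod_ge_rim:
  assumes "z \<in> rim (- int N) (int N) (- int N) (int N)"
  shows "real N * s \<le> cmod z"
proof -
  have "\<bar>Re z\<bar> = real N * s \<or> \<bar>Im z\<bar> = real N * s"
    using assms s_pos by (auto simp: mem_rim)
  then show ?thesis using abs_Re_le_cmod[of z] abs_Im_le_cmod[of z] by linarith
qed

text \<open>The residue at infinity: \<open>\<phi> z - a / z\<close> is o(1/|z|) while the perimeter
  grows like |z|, and \<open>a / z\<close> contributes the limit by
  \<open>rect_integral_inverse\<close>.\<close>

lemma rect_integral_tendsto:
  assumes cont: "continuous_on {z. R \<le> cmod z} \<phi>"
    and lim: "((\<lambda>z. z * \<phi> z) \<longlongrightarrow> a) at_infinity"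
  shows "(\<lambda>N. rect_integral \<phi> (- int N) (int N) (- int N) (int N)) \<longlonglongrightarrow> 2 * of_real pi * \<i> * a"
proof (rule tendstoI)
  fix e :: real assume "e > 0"
  \<comment> \<open>The remainder is at most \<open>\<eta> / (real N * s)\<close> on a rim of length
    8 N s, so the error will be at most \<open>8 * \<eta>\<close>.\<close>
  define \<eta> where "\<eta> = e / 9"
  have \<eta>: "\<eta> > 0" "8 * \<eta> < e" using \<open>e > 0\<close> by (auto simp: \<eta>_def)
  have "\<forall>\<^sub>F z in at_infinity. dist (z * \<phi> z) a < \<eta>" by (rule tendstoD[OF lim \<eta>(1)])
  then obtain b where b: "\<And>z. b \<le> cmod z \<Longrightarrow> cmod (z * \<phi> z - a) < \<eta>"
    by (auto simp: eventually_at_infinity dist_norm)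
  have "\<forall>\<^sub>F N in sequentially. \<bar>R\<bar> + \<bar>b\<bar> + 1 \<le> real N * s"
    using s_pos by real_asymp
  then show "\<forall>\<^sub>F N in sequentially.
      dist (rect_integral \<phi> (- int N) (int N) (- int N) (int N)) (2 * of_real pi * \<i> * a) < e"
  proof eventually_elim
    case (elim N)
    then have N: "N > 0" by (cases "N = 0") auto
    let ?I = "\<lambda>\<phi>. rect_integral \<phi> (- int N) (int N) (- int N) (int N)"
    let ?R = "rim (- int N) (int N) (- int N) (int N)"
    have big: "\<bar>R\<bar> + \<bar>b\<bar> + 1 \<le> cmod z" "z \<noteq> 0" if "z \<in> ?R" for z
      using cmod_ge_rim[OF that] elim by auto
    have c\<phi>: "continuous_on ?R \<phi>"
      by (rule continuous_on_subset[OF cont]) (use big in force)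
    have ci: "continuous_on ?R (\<lambda>z. 1 / z)" using big(2) by (intro continuous_intros) auto
    define \<psi> where "\<psi> = (\<lambda>z. \<phi> z + (- a) * (1 / z))"
    have c\<psi>: "continuous_on ?R \<psi>" unfolding \<psi>_def by (intro continuous_intros c\<phi> ci)
    have "?I \<psi> = ?I \<phi> + (- a) * ?I (\<lambda>z. 1 / z)"
    proof -
      have "continuous_on ?R (\<lambda>z. (- a) * (1 / z))" by (intro continuous_on_mult_left ci)
      then have "?I (\<lambda>z. \<phi> z + (- a) * (1 / z)) = ?I \<phi> + ?I (\<lambda>z. (- a) * (1 / z))"
        by (intro rect_integral_add c\<phi>) auto
      also have "?I (\<lambda>z. (- a) * (1 / z)) = (- a) * ?I (\<lambda>z. 1 / z)"
        by (intro rect_integral_cmult ci) auto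
      finally show ?thesis unfolding \<psi>_def .
    qed
    also have "?I (\<lambda>z. 1 / z) = 2 * of_real pi * \<i>"
      using N by (intro rect_integral_inverse) auto
    finally have eq: "?I \<phi> - 2 * of_real pi * \<i> * a = ?I \<psi>" by (simp add: mult_ac)
    have "cmod (?I \<psi>) \<le> \<eta> / (real N * s) *
        (2 * (of_int (int N - - int N) + of_int (int N - - int N)) * s)"
    proof (rule rect_integral_bound[OF _ _ c\<psi>])
      fix z assume z: "z \<in> ?R"
      have "cmod (\<psi> z) = cmod (z * \<phi> z - a) / cmod z"
        using big(2)[OF z] by (simp add: \<psi>_def field_simps flip: norm_divide)
      also have "\<dots> \<le> \<eta> / (real N * s)"
      proof (rule frac_le)
        show "cmod (z * \<phi> z - a) \<le> \<eta>" using b[of z] big(1)[OF z] by linarith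
      qed (use \<eta> N s_pos cmod_ge_rim[OF z] in auto)
      finally show "cmod (\<psi> z) \<le> \<eta> / (real N * s)" .
    qed (use N s_pos \<eta> in auto)
    also have "\<dots> = 8 * \<eta>" using N s_pos by (simp add: field_simps)
    finally show ?case using \<eta>(2) by (simp add: dist_norm eq)
  qed
qed

end

subsection \<open>Discretization of Lipschitz functions\<close>

text \<open>The points farther than \<open>n\<close> from the base point are at most n^2 in number
  and contribute at most 1 in total. For the others, at offset (x, y), the maximum of |x| and |y| is
  at least 1, so its square is at least (1 + |x|)(1 + |y|) / 4. The sum is then dominated by a
  product of two harmonic sums.\<close>

lemma sum_inverse_square_lattice:
  fixes J :: "(int \<times> int) set"
  assumes "finite J" "card J \<le> n\<^sup>2" "n > 0" "(k0, l0) \<notin> J"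
  shows "(\<Sum>(k, l)\<in>J. 1 / (real_of_int (max \<bar>k - k0\<bar> \<bar>l - l0\<bar>))\<^sup>2) \<le> 1 + 16 * (harm (n + 1))\<^sup>2"
proof -
  define M where "M = (\<lambda>(k, l). real_of_int (max \<bar>k - k0\<bar> \<bar>l - l0\<bar>))"
  define A where "A = {p\<in>J. M p > n}"
  define B where "B = {p\<in>J. M p \<le> n}"
  let ?S = "{- int n..int n}"
  let ?g = "\<lambda>x::int. 1 / (1 + \<bar>real_of_int x\<bar>)"
  have "(\<Sum>(k, l)\<in>J. 1 / (real_of_int (max \<bar>k - k0\<bar> \<bar>l - l0\<bar>))\<^sup>2) = (\<Sum>p\<in>J. 1 / (M p)\<^sup>2)"
    by (auto simp: M_def intro!: sum.cong)
  also have "\<dots> = (\<Sum>p\<in>A. 1 / (M p)\<^sup>2) + (\<Sum>p\<in>B. 1 / (M p)\<^sup>2)"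
    using assms(1) by (subst sum.union_disjoint[symmetric]) (auto simp: A_def B_def intro!: sum.cong)
  also have "(\<Sum>p\<in>A. 1 / (M p)\<^sup>2) \<le> (\<Sum>p\<in>A. 1 / (real n)\<^sup>2)"
    using assms(3) by (intro sum_mono divide_left_mono power_mono) (auto simp: A_def)
  also have "\<dots> = real (card A) / (real n)\<^sup>2" by simp
  also have "card A \<le> card J" using assms(1) by (intro card_mono) (auto simp: A_def)
  then have "real (card A) / (real n)\<^sup>2 \<le> 1"
    using assms(2,3) by (simp add: divide_le_eq flip: of_nat_power)
  also have "(\<Sum>p\<in>B. 1 / (M p)\<^sup>2) \<le> (\<Sum>(k, l)\<in>B. 4 * (?g (k - k0) * ?g (l - l0)))"
  proof (intro sum_mono, clarify)
    fix k l assume kl: "(k, l) \<in> B"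
    let ?a = "\<bar>real_of_int (k - k0)\<bar>" and ?b = "\<bar>real_of_int (l - l0)\<bar>"
    have M: "M (k, l) = max ?a ?b" by (simp add: M_def)
    have "k \<noteq> k0 \<or> l \<noteq> l0" using kl assms(4) by (auto simp: B_def)
    then have "M (k, l) \<ge> 1" unfolding M_def prod.case by linarith
    moreover have "?a \<le> M (k, l)" "?b \<le> M (k, l)" unfolding M by (rule max.cobounded1 max.cobounded2)+
    ultimately have "1 + ?a \<le> 2 * M (k, l)" "1 + ?b \<le> 2 * M (k, l)" by simp_all
    then have "(1 + ?a) * (1 + ?b) \<le> (2 * M (k, l)) * (2 * M (k, l))"
      by (intro mult_mono) auto
    then have "4 / (2 * M (k, l) * (2 * M (k, l))) \<le> 4 / ((1 + ?a) * (1 + ?b))"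
      by (intro divide_left_mono mult_pos_pos) (use \<open>M (k, l) \<ge> 1\<close> in auto)
    then show "1 / (M (k, l))\<^sup>2 \<le> 4 * (?g (k - k0) * ?g (l - l0))"
      by (simp add: power2_eq_square)
  qed
  also have "\<dots> = (\<Sum>(x, y)\<in>(\<lambda>(k, l). (k - k0, l - l0)) ` B. 4 * (?g x * ?g y))"
    by (subst sum.reindex) (auto simp: inj_on_def intro!: sum.cong)
  also have "\<dots> \<le> (\<Sum>(x, y)\<in>?S \<times> ?S. 4 * (?g x * ?g y))"
    by (intro sum_mono2) (auto simp: B_def M_def)
  also have "\<dots> = 4 * (sum ?g ?S)\<^sup>2"
    unfolding power2_eq_square sum_product sum.cartesian_product
    by (simp only: sum_distrib_left case_prod_unfold)
  also have "sum ?g ?S \<le> 2 * harm (n + 1)"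
  proof -
    have "?S \<subseteq> int ` {..n} \<union> (\<lambda>i. - int i) ` {..n}"
    proof
      fix x assume "x \<in> ?S"
      then have "x = int (nat \<bar>x\<bar>) \<or> x = - int (nat \<bar>x\<bar>)" "nat \<bar>x\<bar> \<le> n" by auto
      then show "x \<in> int ` {..n} \<union> (\<lambda>i. - int i) ` {..n}" by blast
    qed
    then have "sum ?g ?S \<le> sum ?g (int ` {..n} \<union> (\<lambda>i. - int i) ` {..n})"
      by (intro sum_mono2) auto
    also have "\<dots> \<le> sum ?g (int ` {..n}) + sum ?g ((\<lambda>i. - int i) ` {..n})"
      using sum.union_inter[of "int ` {..n}" "(\<lambda>i. - int i) ` {..n}" ?g]
        sum_nonneg[of "int ` {..n} \<inter> (\<lambda>i. - int i) ` {..n}" ?g] by simp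
    also have "\<dots> = 2 * (\<Sum>i\<le>n. 1 / (1 + real i))"
      by (subst (1 2) sum.reindex) (auto simp: inj_on_def o_def)
    also have "(\<Sum>i\<le>n. 1 / (1 + real i)) = harm (n + 1)"
      by (induction n) (simp_all add: harm_Suc harm_expand divide_inverse add_ac)
    finally show ?thesis .
  qed
  then have "4 * (sum ?g ?S)\<^sup>2 \<le> 4 * (2 * harm (n + 1))\<^sup>2"
    by (intro mult_left_mono power_mono sum_nonneg) auto
  also have "\<dots> = 16 * (harm (n + 1))\<^sup>2" by (simp add: power_mult_distrib)
  finally show ?thesis by simp
qed

section \<open>Cells near to and far from a given point\<close>

context square_grid
begin

lemma centre_in_cell: "centre k l \<in> cell k l"
  using s_pos by (simp add: mem_rect mult_right_mono)

lemma cmod_diff_centre_le: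
  assumes "z \<in> cell k l"
  shows "cmod (z - centre k l) \<le> s"
proof -
  have "\<bar>Re (z - centre k l)\<bar> \<le> s / 2" "\<bar>Im (z - centre k l)\<bar> \<le> s / 2"
    using assms unfolding abs_le_iff by (auto simp: mem_rect algebra_simps)
  then show ?thesis using cmod_le[of "z - centre k l"] by linarith
qed

text \<open>Intervals of length \<open>s\<close> whose indices differ by d are at distance at least
  (d - 1) s, and this is at least d s / 2 as soon as d is at least 2.\<close>

lemma abs_diff_ge_of_intervals:
  assumes "of_int p * s \<le> x" "x \<le> (of_int p + 1) * s" "of_int q * s \<le> y" "y \<le> (of_int q + 1) * s"
    and "2 \<le> \<bar>p - q\<bar>"
  shows "of_int \<bar>p - q\<bar> * s / 2 \<le> \<bar>x - y\<bar>"
proof -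
  have "2 * s \<le> of_int \<bar>p - q\<bar> * s"
    using assms(5) s_pos by (intro mult_right_mono) auto
  moreover have "of_int \<bar>p - q\<bar> * s = of_int p * s - of_int q * s \<or>
      of_int \<bar>p - q\<bar> * s = of_int q * s - of_int p * s"
    by (auto simp: abs_if algebra_simps)
  ultimately show ?thesis using assms(1-4) unfolding distrib_right mult_1_left by linarith
qed

text \<open>The three by three block of cells around the cell containing \<open>z\<close>; the upper
  ends of the index ranges are excluded.\<close>

definition near :: "complex \<Rightarrow> (int \<times> int) set" where
  "near z = {\<lfloor>Re z / s\<rfloor> - 1..<\<lfloor>Re z / s\<rfloor> + 2} \<times> {\<lfloor>Im z / s\<rfloor> - 1..<\<lfloor>Im z / s\<rfloor> + 2}"

definition index_dist :: "complex \<Rightarrow> int \<Rightarrow> int \<Rightarrow> int" where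
  "index_dist z k l = max \<bar>k - \<lfloor>Re z / s\<rfloor>\<bar> \<bar>l - \<lfloor>Im z / s\<rfloor>\<bar>"

lemma index_dist_ge_2: "(k, l) \<notin> near z \<Longrightarrow> 2 \<le> index_dist z k l"
  by (auto simp: near_def index_dist_def)

lemma own_cell:
  "of_int \<lfloor>Re z / s\<rfloor> * s \<le> Re z" "Re z \<le> (of_int \<lfloor>Re z / s\<rfloor> + 1) * s"
  "of_int \<lfloor>Im z / s\<rfloor> * s \<le> Im z" "Im z \<le> (of_int \<lfloor>Im z / s\<rfloor> + 1) * s"
  using floor_divide_lower[OF s_pos] floor_divide_upper[OF s_pos] less_imp_le by blast+

lemma far_cell_dist:
  assumes "(k, l) \<notin> near z" "w \<in> cell k l"
  shows "of_int (index_dist z k l) * s / 2 \<le> cmod (w - z)"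
proof -
  have "2 \<le> index_dist z k l" using index_dist_ge_2[OF assms(1)] .
  then consider "index_dist z k l = \<bar>k - \<lfloor>Re z / s\<rfloor>\<bar>" "2 \<le> \<bar>k - \<lfloor>Re z / s\<rfloor>\<bar>"
    | "index_dist z k l = \<bar>l - \<lfloor>Im z / s\<rfloor>\<bar>" "2 \<le> \<bar>l - \<lfloor>Im z / s\<rfloor>\<bar>"
    by (auto simp: index_dist_def max_def split: if_splits)
  then show ?thesis
  proof cases
    case 1
    then have "of_int (index_dist z k l) * s / 2 \<le> \<bar>Re w - Re z\<bar>"
      using abs_diff_ge_of_intervals[of k "Re w" "\<lfloor>Re z / s\<rfloor>" "Re z"] own_cell[of z] assms(2)
      by (auto simp: mem_rect)
    then show ?thesis using abs_Re_le_cmod[of "w - z"] by simp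
  next
    case 2
    then have "of_int (index_dist z k l) * s / 2 \<le> \<bar>Im w - Im z\<bar>"
      using abs_diff_ge_of_intervals[of l "Im w" "\<lfloor>Im z / s\<rfloor>" "Im z"] own_cell[of z] assms(2)
      by (auto simp: mem_rect)
    then show ?thesis using abs_Im_le_cmod[of "w - z"] by simp
  qed
qed

text \<open>The lines bounding the block stay a full cell away from \<open>z\<close>. The distance
  \<open>4 * s\<close> is the range in which the Lipschitz condition below is assumed.\<close>

lemma near_rim:
  assumes "w \<in> rim (\<lfloor>Re z / s\<rfloor> - 1) (\<lfloor>Re z / s\<rfloor> + 2) (\<lfloor>Im z / s\<rfloor> - 1) (\<lfloor>Im z / s\<rfloor> + 2)"
  shows "w \<noteq> z" "cmod (w - z) \<le> 4 * s"
proof -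
  show "w \<noteq> z"
    using assms own_cell[of z] s_pos by (auto simp: mem_rim algebra_simps)
  have "\<bar>Re (w - z)\<bar> \<le> 2 * s" "\<bar>Im (w - z)\<bar> \<le> 2 * s"
    using assms own_cell[of z] by (auto simp: mem_rim mem_rect abs_le_iff algebra_simps)
  then show "cmod (w - z) \<le> 4 * s" using cmod_le[of "w - z"] by linarith
qed

definition square :: "nat \<Rightarrow> (int \<times> int) set" where
  "square N = {- int N..<int N} \<times> {- int N..<int N}"

lemma eventually_subset_square:
  assumes "finite A"
  shows "\<forall>\<^sub>F N in sequentially. A \<subseteq> square N"
proof -
  have "\<forall>p\<in>A. \<forall>\<^sub>F N in sequentially. p \<in> square N"
  proof
    fix p :: "int \<times> int"
    show "\<forall>\<^sub>F N in sequentially. p \<in> square N"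
      by (rule eventually_sequentiallyI[of "nat (\<bar>fst p\<bar> + \<bar>snd p\<bar> + 1)"])
         (auto simp: square_def mem_Times_iff)
  qed
  then have "\<forall>\<^sub>F N in sequentially. \<forall>p\<in>A. p \<in> square N"
    using assms by (simp add: eventually_ball_finite_distrib)
  then show ?thesis by (simp add: subset_eq)
qed

end

text \<open>\<open>F\<close> models the cut-off function; \<open>J\<close> is a finite set
  containing every cell not inside the region \<open>V\<close> of holomorphy. The Lipschitz bound is
  asked only at the scale of a block of cells, where the cutoff provides it.\<close>

locale lipschitz_grid = square_grid +
  fixes F :: "complex \<Rightarrow> complex" and V :: "complex set" and J :: "(int \<times> int) set"
    and L :: real and c a :: complex
  assumes lip: "\<And>w z. cmod (w - z) \<le> 4 * s \<Longrightarrow> cmod (F w - F z) \<le> L * cmod (w - z)"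
    and L_nonneg: "L \<ge> 0"
    and hol: "F holomorphic_on V"
    and finite_J: "finite J"
    and outside: "\<And>k l. (k, l) \<notin> J \<Longrightarrow> cell k l \<subseteq> V"
    and lim: "((\<lambda>z. z * (F z - c)) \<longlongrightarrow> a) at_infinity"
begin

section \<open>Coefficients of the rational approximation\<close>

lemma continuous_F: "continuous_on S F"
  unfolding continuous_on_iff
proof (intro ballI allI impI)
  fix x and e :: real assume "e > 0"
  define d where "d = min (4 * s) (e / (L + 1))"
  have "d > 0" using \<open>e > 0\<close> s_pos L_nonneg by (simp add: d_def)
  moreover have "dist (F y) (F x) < e" if "dist y x < d" for y
  proof -
    have y: "cmod (y - x) \<le> 4 * s" "cmod (y - x) < e / (L + 1)"
      using that by (auto simp: d_def dist_norm)
    have "cmod (F y - F x) \<le> L * cmod (y - x)" using lip[OF y(1)] .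
    also have "\<dots> \<le> (L + 1) * cmod (y - x)" by (intro mult_right_mono) auto
    also have "\<dots> < e" using y(2) L_nonneg by (simp add: pos_less_divide_eq mult.commute)
    finally show ?thesis by (simp add: dist_norm)
  qed
  ultimately show "\<exists>d>0. \<forall>x'\<in>S. dist x' x < d \<longrightarrow> dist (F x') (F x) < e" by blast
qed

definition coeff :: "int \<Rightarrow> int \<Rightarrow> complex" where
  "coeff k l = cell_integral F k l / (2 * of_real pi * \<i>)"

lemma cell_integral_diff_const: "cell_integral (\<lambda>z. F z - b) k l = cell_integral F k l"
proof -
  have "cell_integral (\<lambda>z. F z + (- b)) k l = cell_integral F k l + cell_integral (\<lambda>_. - b) k l"
    by (intro rect_integral_add continuous_F) auto
  also have "cell_integral (\<lambda>_. - b) k l = 0" by (intro rect_integral_holomorphic) auto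
  finally show ?thesis by simp
qed

lemma cell_integral_outside: "(k, l) \<notin> J \<Longrightarrow> cell_integral F k l = 0"
  using hol outside by (intro rect_integral_holomorphic) (auto intro: holomorphic_on_subset)

text \<open>\<open>F - c\<close> behaves like a/z, so its integrals around large squares tend to 2
  \<pi> i a; once the square covers \<open>J\<close> they are constant. Subtracting \<open>c\<close>
  changes no cell integral.\<close>

lemma sum_coeff: "(\<Sum>(k, l)\<in>J. coeff k l) = a"
proof -
  have "(\<lambda>N. rect_integral (\<lambda>z. F z - c) (- int N) (int N) (- int N) (int N))
      \<longlonglongrightarrow> 2 * of_real pi * \<i> * a"
    by (rule rect_integral_tendsto[of 0, OF _ lim]) (intro continuous_intros continuous_F)
  moreover have "\<forall>\<^sub>F N in sequentially. rect_integral (\<lambda>z. F z - c) (- int N) (int N) (- int N) (int N) =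
      (\<Sum>(k, l)\<in>J. cell_integral F k l)"
    using eventually_subset_square[OF finite_J]
  proof eventually_elim
    case (elim N)
    have "rect_integral (\<lambda>z. F z - c) (- int N) (int N) (- int N) (int N) =
        (\<Sum>(k, l)\<in>square N. cell_integral F k l)"
      unfolding square_def
      by (subst sum_cell_integral[symmetric])
         (auto intro!: continuous_intros continuous_F simp: cell_integral_diff_const sum.cartesian_product)
    also have "\<dots> = (\<Sum>(k, l)\<in>J. cell_integral F k l)"
      using elim by (intro sum.mono_neutral_right) (auto simp: square_def cell_integral_outside)
    finally show ?case .
  qed
  ultimately have "(\<lambda>N::nat. (\<Sum>(k, l)\<in>J. cell_integral F k l)) \<longlonglongrightarrow> 2 * of_real pi * \<i> * a"
    by (simp only: tendsto_cong)
  then have "(\<Sum>(k, l)\<in>J. cell_integral F k l) = 2 * of_real pi * \<i> * a"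
    by (rule LIMSEQ_unique[OF tendsto_const])
  then show ?thesis
    by (simp add: coeff_def case_prod_unfold flip: sum_divide_distrib)
qed

text \<open>Subtracting \<open>F (centre k l)\<close> leaves an integrand of size at most
  \<open>L * s\<close> on a rim of length \<open>4 * s\<close>, and 4 \<le> 2 \<pi>.\<close>

lemma coeff_bound: "cmod (coeff k l) \<le> L * s\<^sup>2"
proof -
  have "cmod (cell_integral (\<lambda>z. F z - F (centre k l)) k l) \<le>
      L * s * (2 * (of_int (k + 1 - k) + of_int (l + 1 - l)) * s)"
  proof (rule rect_integral_bound)
    fix z assume "z \<in> rim k (k + 1) l (l + 1)"
    then have "cmod (z - centre k l) \<le> s" using rim_subset_rect cmod_diff_centre_le by blast
    then show "cmod (F z - F (centre k l)) \<le> L * s"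
      using lip[of z "centre k l"] s_pos L_nonneg mult_left_mono[of "cmod (z - centre k l)" s L]
      by linarith
  qed (use L_nonneg s_pos in \<open>auto intro!: continuous_intros continuous_F\<close>)
  then have "cmod (cell_integral F k l) \<le> 4 * L * s\<^sup>2"
    by (simp add: cell_integral_diff_const power2_eq_square)
  moreover have "4 * (L * s\<^sup>2) \<le> (2 * pi) * (L * s\<^sup>2)"
    using pi_gt3 L_nonneg by (intro mult_right_mono) auto
  ultimately show ?thesis
    by (simp add: coeff_def norm_divide norm_mult divide_le_eq mult_ac)
qed

text \<open>The Cauchy kernel applied to \<open>F w - F z\<close>; the subtraction keeps it bounded
  by \<open>L\<close> near \<open>z\<close>, where \<open>F\<close> may fail to be
  holomorphic.\<close>

definition quotient :: "complex \<Rightarrow> complex \<Rightarrow> complex" where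
  "quotient z w = (F w - F z) / (w - z)"

text \<open>Freezing the kernel at the centre of a far cell costs only a product of two small
  quantities: the oscillation of \<open>F\<close> and that of the kernel.\<close>

lemma cell_integral_quotient:
  assumes far: "(k, l) \<notin> near z"
  shows "cmod (cell_integral (quotient z) k l - cell_integral F k l / (centre k l - z)) \<le>
    16 * L * s / (of_int (index_dist z k l))\<^sup>2"
proof -
  define p where "p = centre k l"
  define d where "d = of_int (index_dist z k l) * s / 2"
  have d: "d > 0" using index_dist_ge_2[OF far] s_pos by (simp add: d_def)
  have dist: "d \<le> cmod (w - z)" if "w \<in> cell k l" for w
    using far_cell_dist[OF far that] by (simp add: d_def)
  have ne: "w \<noteq> z" if "w \<in> cell k l" for w using dist[OF that] d by auto
  have p: "p \<in> cell k l" by (simp add: p_def centre_in_cell)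
  \<comment> \<open>The quotient is \<open>F w / (p - z)\<close> plus \<open>H\<close> plus
    \<open>R\<close>, where \<open>H\<close> is holomorphic on the cell and \<open>R\<close> is the
    product of the two oscillations.\<close>
  define H where "H = (\<lambda>w. (F p - F z) / (w - z) - F p / (p - z))"
  define R where "R = (\<lambda>w. (F w - F p) * (1 / (w - z) - 1 / (p - z)))"
  have H: "H holomorphic_on cell k l"
    unfolding H_def using ne by (intro holomorphic_intros) auto
  have contH: "continuous_on (rim k (k + 1) l (l + 1)) H"
    using H rim_subset_rect holomorphic_on_imp_continuous_on continuous_on_subset by blast
  have contR: "continuous_on (rim k (k + 1) l (l + 1)) R"
    unfolding R_def using ne ne[OF p] rim_subset_rect[of k "k + 1" l "l + 1"]
    by (intro continuous_intros continuous_F) auto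
  have eq: "quotient z = (\<lambda>w. 1 / (p - z) * F w + (H w + R w))"
    by (simp add: fun_eq_iff quotient_def H_def R_def diff_divide_distrib algebra_simps)
  have "cell_integral (quotient z) k l =
      cell_integral (\<lambda>w. 1 / (p - z) * F w) k l + cell_integral (\<lambda>w. H w + R w) k l"
    unfolding eq
    by (intro rect_integral_add continuous_on_mult_left continuous_F continuous_on_add contH contR) auto
  also have "cell_integral (\<lambda>w. H w + R w) k l = cell_integral H k l + cell_integral R k l"
    by (intro rect_integral_add contH contR) auto
  also have "cell_integral (\<lambda>w. 1 / (p - z) * F w) k l = 1 / (p - z) * cell_integral F k l"
    by (intro rect_integral_cmult continuous_F) auto
  also have "cell_integral H k l = 0" by (intro rect_integral_holomorphic H) auto
  finally have "cell_integral (quotient z) k l - cell_integral F k l / (p - z) = cell_integral R k l"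
    by simp
  also have "cmod (cell_integral R k l) \<le> L * s * (s / d\<^sup>2) * (2 * (of_int (k + 1 - k) + of_int (l + 1 - l)) * s)"
  proof (rule rect_integral_bound[OF _ _ contR])
    fix w assume "w \<in> rim k (k + 1) l (l + 1)"
    then have w: "w \<in> cell k l" using rim_subset_rect by blast
    have wp: "cmod (w - p) \<le> s" unfolding p_def using w by (rule cmod_diff_centre_le)
    have "cmod (F w - F p) \<le> L * s"
      using lip[of w p] wp s_pos L_nonneg mult_left_mono[of "cmod (w - p)" s L] by linarith
    moreover have "cmod (1 / (w - z) - 1 / (p - z)) \<le> s / d\<^sup>2"
    proof -
      have "1 / (w - z) - 1 / (p - z) = (p - w) / ((w - z) * (p - z))"
        using ne[OF w] ne[OF p] by (simp add: divide_simps)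
      also have "cmod \<dots> = cmod (w - p) / (cmod (w - z) * cmod (p - z))"
        by (simp add: norm_divide norm_mult norm_minus_commute)
      also have "\<dots> \<le> s / (d * d)"
        using wp dist[OF w] dist[OF p] d s_pos by (intro frac_le mult_mono) auto
      finally show ?thesis by (simp add: power2_eq_square)
    qed
    ultimately show "cmod (R w) \<le> L * s * (s / d\<^sup>2)"
      unfolding R_def norm_mult using L_nonneg s_pos by (intro mult_mono) auto
  qed (use L_nonneg s_pos in auto)
  also have "\<dots> = 16 * L * s / (of_int (index_dist z k l))\<^sup>2"
    using s_pos by (simp add: d_def power2_eq_square field_simps)
  finally show ?thesis by (simp add: p_def)
qed

text \<open>A discrete Cauchy-Pompeiu formula, from the limit over large squares. The cells near
  \<open>z\<close> are merged into the boundary integral of their block, which avoids the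
  singularity; other cells outside \<open>J\<close> integrate to 0.\<close>

lemma sum_quotient:
  "rect_integral (quotient z) (\<lfloor>Re z / s\<rfloor> - 1) (\<lfloor>Re z / s\<rfloor> + 2) (\<lfloor>Im z / s\<rfloor> - 1) (\<lfloor>Im z / s\<rfloor> + 2) +
   (\<Sum>(k, l)\<in>J - near z. cell_integral (quotient z) k l) = 2 * of_real pi * \<i> * (c - F z)"
  (is "?N + ?S = _")
proof -
  have contq: "continuous_on S (quotient z)" if "z \<notin> S" for S
    unfolding quotient_def using that by (intro continuous_intros continuous_F) auto
  have near: "?N = (\<Sum>(k, l)\<in>near z. cell_integral (quotient z) k l)"
    unfolding near_def using near_rim(1)
    by (subst sum_cell_integral[symmetric]) (auto intro!: contq simp: sum.cartesian_product)
  have "(\<lambda>N. rect_integral (quotient z) (- int N) (int N) (- int N) (int N))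
      \<longlonglongrightarrow> 2 * of_real pi * \<i> * (c - F z)"
  proof (rule rect_integral_tendsto[of "cmod z + 1"])
    have cF: "(F \<longlongrightarrow> c) at_infinity" using lim by (rule tendsto_const_at_infinity)
    have "((\<lambda>w. (F w - F z) / (1 - z * inverse w)) \<longlongrightarrow> (c - F z) / (1 - z * 0)) at_infinity"
      by (intro tendsto_intros cF tendsto_inverse_0) auto
    moreover have "\<forall>\<^sub>F w in at_infinity. (F w - F z) / (1 - z * inverse w) = w * quotient z w"
      using eventually_not_equal_at_infinity[of 0] eventually_not_equal_at_infinity[of z]
      by eventually_elim (auto simp: quotient_def divide_simps)
    ultimately show "((\<lambda>w. w * quotient z w) \<longlongrightarrow> c - F z) at_infinity"
      by (simp add: tendsto_cong)
  qed (auto intro!: contq)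
  moreover have "\<forall>\<^sub>F N in sequentially.
      rect_integral (quotient z) (- int N) (int N) (- int N) (int N) = ?N + ?S"
  proof -
    have "finite (J \<union> near z)" using finite_J by (simp add: near_def)
    from eventually_subset_square[OF this]
    have "\<forall>\<^sub>F N in sequentially. J \<union> near z \<subseteq> square N" .
    moreover have "\<forall>\<^sub>F N in sequentially. cmod z + 1 \<le> real N * s" using s_pos by real_asymp
    ultimately show ?thesis
    proof eventually_elim
      case (elim N)
      have "z \<notin> rim (- int N) (int N) (- int N) (int N)" using cmod_ge_rim[of z N] elim(2) by auto
      then have "rect_integral (quotient z) (- int N) (int N) (- int N) (int N) =
          (\<Sum>(k, l)\<in>square N. cell_integral (quotient z) k l)"
        unfolding square_def
        by (subst sum_cell_integral[symmetric]) (auto intro!: contq simp: sum.cartesian_product)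
      also have "square N = near z \<union> (square N - near z)" using elim(1) by blast
      also have "(\<Sum>(k, l)\<in>near z \<union> (square N - near z). cell_integral (quotient z) k l) =
          ?N + (\<Sum>(k, l)\<in>square N - near z. cell_integral (quotient z) k l)"
        unfolding near by (intro sum.union_disjoint) (auto simp: near_def square_def)
      also have "(\<Sum>(k, l)\<in>square N - near z. cell_integral (quotient z) k l) = ?S"
      proof (intro sum.mono_neutral_right, goal_cases)
        case 3
        have "cell_integral (quotient z) k l = 0" if kl: "(k, l) \<notin> J" "(k, l) \<notin> near z" for k l
        proof (rule rect_integral_holomorphic)
          have "w \<noteq> z" if "w \<in> cell k l" for w
          proof -
            have "0 < of_int (index_dist z k l) * s / 2" using index_dist_ge_2[OF kl(2)] s_pos by simp
            then show ?thesis using far_cell_dist[OF kl(2) that] by auto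
          qed
          then show "quotient z holomorphic_on cell k l"
            unfolding quotient_def using hol outside[OF kl(1)]
            by (intro holomorphic_intros) (auto intro: holomorphic_on_subset)
        qed auto
        then show ?case by auto
      qed (use elim(1) in \<open>auto simp: square_def\<close>)
      finally show ?case .
    qed
  qed
  ultimately have "(\<lambda>N::nat. ?N + ?S) \<longlonglongrightarrow> 2 * of_real pi * \<i> * (c - F z)"
    by (simp only: tendsto_cong)
  then show ?thesis by (rule LIMSEQ_unique[OF tendsto_const])
qed

text \<open>In \<open>sum_quotient\<close> the block contributes at most \<open>L\<close> times its
  perimeter, and each far cell differs from its pole term by the error in
  \<open>cell_integral_quotient\<close>.\<close>

lemma far_approximation:
  "cmod (F z - c - (\<Sum>(k, l)\<in>J - near z. coeff k l / (z - centre k l))) \<le>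
     L * s * (2 + 3 * (\<Sum>(k, l)\<in>J - near z. 1 / (of_int (index_dist z k l))\<^sup>2))"
proof -
  let ?N = "rect_integral (quotient z) (\<lfloor>Re z / s\<rfloor> - 1) (\<lfloor>Re z / s\<rfloor> + 2) (\<lfloor>Im z / s\<rfloor> - 1) (\<lfloor>Im z / s\<rfloor> + 2)"
  let ?D = "\<lambda>k l. cell_integral (quotient z) k l - cell_integral F k l / (centre k l - z)"
  define T where "T = (\<Sum>(k, l)\<in>J - near z. 1 / (real_of_int (index_dist z k l))\<^sup>2)"
  have T: "T \<ge> 0" unfolding T_def by (intro sum_nonneg) auto
  have coeffs: "cell_integral F k l = 2 * of_real pi * \<i> * coeff k l" for k l by (simp add: coeff_def)
  have "(\<Sum>(k, l)\<in>J - near z. ?D k l) = (\<Sum>(k, l)\<in>J - near z. cell_integral (quotient z) k l) -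
      (\<Sum>(k, l)\<in>J - near z. cell_integral F k l / (centre k l - z))"
    by (simp add: case_prod_unfold sum_subtractf)
  also have "(\<Sum>(k, l)\<in>J - near z. cell_integral F k l / (centre k l - z)) =
      - (2 * of_real pi * \<i>) * (\<Sum>(k, l)\<in>J - near z. coeff k l / (z - centre k l))"
  proof -
    have "x * b / (p - z) = - x * (b / (z - p))" for x b p :: complex
    proof -
      have "x * b / - (z - p) = - x * (b / (z - p))" by (simp del: minus_diff_eq)
      then show ?thesis by simp
    qed
    then show ?thesis unfolding sum_distrib_left coeffs case_prod_unfold by (intro sum.cong) auto
  qed
  finally have "?N + (\<Sum>(k, l)\<in>J - near z. ?D k l) =
      - (2 * of_real pi * \<i>) * (F z - c - (\<Sum>(k, l)\<in>J - near z. coeff k l / (z - centre k l)))"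
    using sum_quotient[of z] by (simp add: algebra_simps)
  then have "2 * pi * cmod (F z - c - (\<Sum>(k, l)\<in>J - near z. coeff k l / (z - centre k l))) =
      cmod (?N + (\<Sum>(k, l)\<in>J - near z. ?D k l))"
    by (simp add: norm_mult)
  also have "\<dots> \<le> cmod ?N + (\<Sum>(k, l)\<in>J - near z. cmod (?D k l))"
    by (intro order_trans[OF norm_triangle_ineq] add_mono order_refl order_trans[OF norm_sum])
       (simp add: case_prod_unfold)
  also have "cmod ?N \<le> 12 * L * s"
  proof -
    have "cmod ?N \<le> L * (2 * (of_int ((\<lfloor>Re z / s\<rfloor> + 2) - (\<lfloor>Re z / s\<rfloor> - 1)) +
        of_int ((\<lfloor>Im z / s\<rfloor> + 2) - (\<lfloor>Im z / s\<rfloor> - 1))) * s)"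
    proof (rule rect_integral_bound)
      show "continuous_on (rim (\<lfloor>Re z / s\<rfloor> - 1) (\<lfloor>Re z / s\<rfloor> + 2) (\<lfloor>Im z / s\<rfloor> - 1) (\<lfloor>Im z / s\<rfloor> + 2)) (quotient z)"
        unfolding quotient_def using near_rim(1) by (intro continuous_intros continuous_F) auto
      fix w assume "w \<in> rim (\<lfloor>Re z / s\<rfloor> - 1) (\<lfloor>Re z / s\<rfloor> + 2) (\<lfloor>Im z / s\<rfloor> - 1) (\<lfloor>Im z / s\<rfloor> + 2)"
      from near_rim[OF this] show "cmod (quotient z w) \<le> L"
        using lip[of w z] by (simp add: quotient_def norm_divide divide_le_eq)
    qed (use L_nonneg in auto)
    then show ?thesis by simp
  qed
  also have "(\<Sum>(k, l)\<in>J - near z. cmod (?D k l)) \<le>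
      (\<Sum>(k, l)\<in>J - near z. 16 * L * s / (of_int (index_dist z k l))\<^sup>2)"
    by (intro sum_mono) (auto intro: cell_integral_quotient)
  also have "\<dots> = 16 * L * s * T"
    by (simp add: T_def sum_distrib_left case_prod_unfold)
  finally have "2 * pi * cmod (F z - c - (\<Sum>(k, l)\<in>J - near z. coeff k l / (z - centre k l))) \<le>
      12 * L * s + 16 * L * s * T" by simp
  \<comment> \<open>Rounded up to a multiple of 6, so that 6 \<le> 2 \<pi> can absorb the factor on
    the left.\<close>
  also have "\<dots> \<le> 6 * (L * s * (2 + 3 * T))"
    using L_nonneg s_pos T by (simp add: algebra_simps)
  also have "\<dots> \<le> 2 * pi * (L * s * (2 + 3 * T))"
    using pi_gt3 L_nonneg s_pos T by (intro mult_right_mono) auto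
  finally show ?thesis unfolding T_def by simp
qed

text \<open>At most nine terms belong to cells near \<open>z\<close>, each of size at most
  \<open>3 * L * s\<close> since \<open>z\<close> keeps away from the centres; the others are
  covered by the lattice sum. The constant 32 is 2 + 3 + 27.\<close>

lemma approximation:
  assumes "card J \<le> n\<^sup>2" "n > 0"
    and away: "\<And>k l. (k, l) \<in> J \<Longrightarrow> s / 3 < cmod (z - centre k l)"
  shows "cmod (F z - (c + (\<Sum>(k, l)\<in>J. coeff k l / (z - centre k l)))) \<le>
     L * s * (32 + 48 * (harm (n + 1))\<^sup>2)"
proof -
  let ?f = "\<lambda>(k, l). coeff k l / (z - centre k l)"
  have "sum ?f J = sum ?f (J - near z) + sum ?f (J \<inter> near z)"
    using finite_J by (subst sum.union_disjoint[symmetric]) (auto intro!: sum.cong)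
  then have "cmod (F z - (c + sum ?f J)) = cmod ((F z - c - sum ?f (J - near z)) - sum ?f (J \<inter> near z))"
    by (simp add: algebra_simps)
  also have "\<dots> \<le> cmod (F z - c - sum ?f (J - near z)) + cmod (sum ?f (J \<inter> near z))"
    by (rule norm_triangle_ineq4)
  also have "cmod (sum ?f (J \<inter> near z)) \<le> (\<Sum>p\<in>J \<inter> near z. 3 * L * s)"
  proof (rule sum_norm_le, clarify)
    fix k l assume "(k, l) \<in> J"
    then have "s / 3 \<le> cmod (z - centre k l)" using away[of k l] by simp
    then have "cmod (coeff k l) / cmod (z - centre k l) \<le> (L * s\<^sup>2) / (s / 3)"
      using coeff_bound[of k l] s_pos L_nonneg by (intro frac_le) auto
    then show "cmod (coeff k l / (z - centre k l)) \<le> 3 * L * s"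
      using s_pos by (simp add: norm_divide power2_eq_square)
  qed
  also have "\<dots> \<le> 9 * (3 * L * s)"
  proof -
    have "card (J \<inter> near z) \<le> card (near z)" by (intro card_mono) (auto simp: near_def)
    also have "\<dots> = 9" by (simp add: near_def card_cartesian_product)
    finally show ?thesis
      using L_nonneg s_pos by (simp only: sum_constant) (intro mult_right_mono; simp)
  qed
  also have "cmod (F z - c - sum ?f (J - near z)) \<le> L * s * (2 + 3 * (1 + 16 * (harm (n + 1))\<^sup>2))"
  proof -
    have "card (J - near z) \<le> n\<^sup>2"
      using assms(1) finite_J card_mono[of J "J - near z"] by auto
    then have "(\<Sum>(k, l)\<in>J - near z. 1 / (real_of_int (index_dist z k l))\<^sup>2) \<le> 1 + 16 * (harm (n + 1))\<^sup>2"
      unfolding index_dist_def using finite_J assms(2)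
      by (intro sum_inverse_square_lattice) (auto simp: near_def)
    then have "L * s * (2 + 3 * (\<Sum>(k, l)\<in>J - near z. 1 / (real_of_int (index_dist z k l))\<^sup>2)) \<le>
        L * s * (2 + 3 * (1 + 16 * (harm (n + 1))\<^sup>2))"
      using L_nonneg s_pos by (intro mult_left_mono) auto
    then show ?thesis using far_approximation[of z] by linarith
  qed
  finally show ?thesis by (simp add: algebra_simps)
qed

end

subsection \<open>Approximation by equal disjoint disks\<close>

text \<open>The error of \<open>approximation\<close> for mesh \<open>1 / q\<close>: harmonic
  numbers grow like logarithms, so it is of order (log q)^2 / q. The number
  \<open>2 * D * q + 3\<close> will be the side, in cells, of a square covering
  \<open>J\<close>.\<close>

lemma eventually_harm_error_le:
  assumes "D > 0" "\<epsilon> > 0"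
  shows "\<forall>\<^sub>F q in sequentially.
    L * (1 / real q) * (32 + 48 * (harm (2 * D * q + 3 + 1))\<^sup>2) \<le> \<epsilon>"
proof -
  have "((\<lambda>q. \<bar>L\<bar> * ((1 / real q) * (32 + 48 * (ln (2 * real D * real q + 4) + 1)\<^sup>2)))
      \<longlongrightarrow> \<bar>L\<bar> * 0) sequentially"
    using assms(1) by (intro tendsto_mult_left) real_asymp
  then have "\<forall>\<^sub>F q in sequentially.
      \<bar>L\<bar> * ((1 / real q) * (32 + 48 * (ln (2 * real D * real q + 4) + 1)\<^sup>2)) < \<epsilon>"
    by (rule order_tendstoD(2)) (use assms(2) in simp)
  then show ?thesis
  proof eventually_elim
    case (elim q)
    \<comment> \<open>\<open>harm n - ln n\<close> is decreasing and equals 1 at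
      \<open>n = 1\<close>.\<close>
    have "harm (2 * D * q + 3 + 1) \<le> ln (real (2 * D * q + 3 + 1)) + 1"
      using euler_mascheroni_sequence_decreasing[of 1 "2 * D * q + 3 + 1"]
      by (simp add: harm_Suc[of 0] harm_expand(1))
    then have "(harm (2 * D * q + 3 + 1))\<^sup>2 \<le> (ln (2 * real D * real q + 4) + 1)\<^sup>2"
      by (intro power_mono harm_nonneg) (simp add: add_ac)
    then have "(1 / real q) * (32 + 48 * (harm (2 * D * q + 3 + 1))\<^sup>2) \<le>
        (1 / real q) * (32 + 48 * (ln (2 * real D * real q + 4) + 1)\<^sup>2)"
      by (intro mult_left_mono) auto
    then have "\<bar>L\<bar> * ((1 / real q) * (32 + 48 * (harm (2 * D * q + 3 + 1))\<^sup>2)) < \<epsilon>"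
      using elim by (smt (verit) mult_left_mono abs_ge_zero)
    moreover have "L * ((1 / real q) * (32 + 48 * (harm (2 * D * q + 3 + 1))\<^sup>2)) \<le>
        \<bar>L\<bar> * ((1 / real q) * (32 + 48 * (harm (2 * D * q + 3 + 1))\<^sup>2))"
      by (intro mult_right_mono) auto
    ultimately show ?case by (simp add: mult.assoc)
  qed
qed

section \<open>Cutting off a bounded holomorphic function\<close>

lemma infdist_le_add_dist:
  "infdist x A \<le> infdist y A + cmod (x - y)"
  using infdist_triangle[of x A y] by (simp add: dist_norm)

definition cutoff :: "complex set \<Rightarrow> real \<Rightarrow> complex \<Rightarrow> real" where
  "cutoff K \<eta> z = min 1 (max 0 (infdist z K / \<eta> - 1))"

lemma cutoff_range: "0 \<le> cutoff K \<eta> z" "cutoff K \<eta> z \<le> 1"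
  by (auto simp: cutoff_def)

lemma cutoff_eq_0: "\<eta> > 0 \<Longrightarrow> infdist z K \<le> \<eta> \<Longrightarrow> cutoff K \<eta> z = 0"
  by (simp add: cutoff_def)

lemma cutoff_eq_1: "\<eta> > 0 \<Longrightarrow> 2 * \<eta> \<le> infdist z K \<Longrightarrow> cutoff K \<eta> z = 1"
  by (simp add: cutoff_def field_simps)

lemma cutoff_lipschitz:
  assumes "\<eta> > 0"
  shows "\<bar>cutoff K \<eta> w - cutoff K \<eta> z\<bar> \<le> cmod (w - z) / \<eta>"
proof -
  have "\<bar>min 1 (max 0 (x - 1)) - min 1 (max 0 (y - 1))\<bar> \<le> \<bar>x - y\<bar>" for x y :: real
    by (auto simp: min_def max_def)
  then have "\<bar>cutoff K \<eta> w - cutoff K \<eta> z\<bar> \<le> \<bar>infdist w K / \<eta> - infdist z K / \<eta>\<bar>"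
    unfolding cutoff_def .
  also have "\<dots> = \<bar>infdist w K - infdist z K\<bar> / \<eta>"
    using assms by (simp flip: diff_divide_distrib)
  also have "\<dots> \<le> cmod (w - z) / \<eta>"
    using infdist_le_add_dist[of w K z] infdist_le_add_dist[of z K w] assms
    by (intro divide_right_mono) (auto simp: norm_minus_commute)
  finally show ?thesis .
qed

text \<open>Points within \<eta>/2 of \<open>z\<close> are still at distance more than \<eta>/2 from
  \<open>K\<close>, so Cauchy's estimate bounds the derivative there by 2/\<eta>.\<close>

lemma bounded_holomorphic_lipschitz:
  assumes K: "closed K" and hol: "f holomorphic_on - K" and bd: "\<And>z. z \<in> - K \<Longrightarrow> cmod (f z) \<le> 1"
    and "\<eta> > 0" "\<eta> < infdist z K" "cmod (w - z) \<le> \<eta> / 2"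
  shows "cmod (f w - f z) \<le> 2 / \<eta> * cmod (w - z)"
proof (rule field_differentiable_bound[of "cball z (\<eta> / 2)"])
  fix x assume x: "x \<in> cball z (\<eta> / 2)"
  have "infdist x K > \<eta> / 2"
    using infdist_le_add_dist[of z K x] assms(5) x by (simp add: dist_norm)
  then have sub: "cball x (\<eta> / 2) \<subseteq> - K"
  proof (intro subsetI ComplI)
    fix y assume "y \<in> cball x (\<eta> / 2)" "y \<in> K" "\<eta> / 2 < infdist x K"
    then show False using infdist_le[of y K x] by (simp add: dist_norm)
  qed
  moreover have "x \<in> cball x (\<eta> / 2)" using \<open>\<eta> > 0\<close> by simp
  ultimately have "x \<in> - K" by blast
  then have "(f has_field_derivative deriv f x) (at x)"
    using hol K by (intro holomorphic_derivI) auto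
  then show "(f has_field_derivative deriv f x) (at x within cball z (\<eta> / 2))"
    by (rule has_field_derivative_at_within)
  have "norm ((deriv ^^ 1) f x) \<le> fact 1 * 1 / (\<eta> / 2) ^ 1"
  proof (rule Cauchy_inequality)
    show "f holomorphic_on ball x (\<eta> / 2)"
      using hol sub by (meson ball_subset_cball holomorphic_on_subset order_trans)
    show "continuous_on (cball x (\<eta> / 2)) f"
      using hol sub holomorphic_on_imp_continuous_on continuous_on_subset by blast
    show "norm (f y) \<le> 1" if "norm (x - y) = \<eta> / 2" for y
      using that sub by (intro bd) (auto simp: dist_norm)
  qed (use \<open>\<eta> > 0\<close> in auto)
  then show "cmod (deriv f x) \<le> 2 / \<eta>" by simp
qed (use assms in \<open>auto simp: dist_norm norm_minus_commute\<close>)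

text \<open>The constant is 2/\<eta> from \<open>f\<close> plus 1/\<eta> from the cutoff. If both
  points are within \<eta> of \<open>K\<close> the products vanish; otherwise \<open>key\<close>
  expands the difference at one that is farther away.\<close>

lemma cutoff_mult_lipschitz:
  assumes K: "closed K" and hol: "f holomorphic_on - K" and bd: "\<And>z. z \<in> - K \<Longrightarrow> cmod (f z) \<le> 1"
    and \<eta>: "\<eta> > 0" and wz: "cmod (w - z) \<le> \<eta> / 2"
  shows "cmod (of_real (cutoff K \<eta> w) * f w - of_real (cutoff K \<eta> z) * f z) \<le> 3 / \<eta> * cmod (w - z)"
proof -
  let ?u = "cutoff K \<eta>"
  have key: "cmod (of_real (?u y) * f y - of_real (?u x) * f x) \<le> 3 / \<eta> * cmod (y - x)"
    if x: "\<eta> < infdist x K" and yx: "cmod (y - x) \<le> \<eta> / 2" for x y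
  proof -
    have "x \<in> - K" using x \<eta> infdist_zero[of x K] by force
    have "of_real (?u y) * f y - of_real (?u x) * f x =
        of_real (?u y) * (f y - f x) + of_real (?u y - ?u x) * f x"
      by (simp add: algebra_simps)
    also have "cmod \<dots> \<le> \<bar>?u y\<bar> * cmod (f y - f x) + \<bar>?u y - ?u x\<bar> * cmod (f x)"
      by (rule order_trans[OF norm_triangle_ineq]) (simp add: norm_mult del: of_real_diff)
    also have "\<dots> \<le> 1 * (2 / \<eta> * cmod (y - x)) + cmod (y - x) / \<eta> * 1"
      using bounded_holomorphic_lipschitz[OF K hol bd \<eta> x yx] cutoff_lipschitz[OF \<eta>]
        cutoff_range[of K \<eta> y] bd[OF \<open>x \<in> - K\<close>] \<eta>
      by (intro add_mono mult_mono) auto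
    finally show ?thesis by (simp add: field_simps)
  qed
  consider "infdist w K \<le> \<eta>" "infdist z K \<le> \<eta>" | "\<eta> < infdist z K" | "\<eta> < infdist w K"
    by linarith
  then show ?thesis
  proof cases
    case 1
    then show ?thesis using \<eta> by (simp add: cutoff_eq_0)
  next
    case 2
    then show ?thesis using key wz by blast
  next
    case 3
    then show ?thesis using key[of w z] wz by (simp add: norm_minus_commute)
  qed
qed

text \<open>The cut-off function is replaced by a rational function with poles at cell centres near
  \<open>K\<close>, which has the same coefficient at infinity and is bounded by 1 + \<epsilon> off
  small disks around its poles.\<close>

lemma disk_approximation:
  assumes K: "compact K" "K \<noteq> {}" and f: "admissible K f c a" and "\<delta> > 0" "\<epsilon> > 0"
  obtains r P where "0 < r" "r \<le> \<delta>" "finite P" "\<And>p. p \<in> P \<Longrightarrow> infdist p K < \<delta>"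
    "\<And>p q. p \<in> P \<Longrightarrow> q \<in> P \<Longrightarrow> p \<noteq> q \<Longrightarrow> 2 * r < dist p q"
    "cmod a \<le> (1 + \<epsilon>) * analytic_capacity (\<Union>p\<in>P. cball p r)"
proof -
  have closed: "closed K" using K(1) by (rule compact_imp_closed)
  have hol: "f holomorphic_on - K" and bd: "\<And>z. z \<in> - K \<Longrightarrow> cmod (f z) \<le> 1"
    and lim: "((\<lambda>z. z * (f z - c)) \<longlongrightarrow> a) at_infinity"
    using f by (auto simp: admissible_def)
  \<comment> \<open>Cells in \<open>J\<close> will have centres within
    \<open>2 * \<eta> + 2 * s\<close> of \<open>K\<close>, which is less than
    \<open>3 * \<eta>\<close>.\<close>
  define \<eta> where "\<eta> = \<delta> / 3"
  have \<eta>: "\<eta> > 0" using assms by (simp add: \<eta>_def)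
  obtain B where B: "\<And>z. z \<in> K \<Longrightarrow> cmod z \<le> B" "B > 0"
    using compact_imp_bounded[OF K(1)] bounded_pos by metis
  \<comment> \<open>An integer bound for the modulus on the \<open>3 * \<eta>\<close>-neighbourhood
    of \<open>K\<close>: it controls the centres, and \<open>F\<close> agrees with \<open>f\<close>
    beyond it.\<close>
  define D where "D = nat \<lceil>B + 3 * \<eta>\<rceil>"
  have D: "D > 0" "B + 3 * \<eta> \<le> real D" using B(2) \<eta> by (auto simp: D_def intro: real_nat_ceiling_ge)
  define L where "L = 3 / \<eta>"
  have L: "L \<ge> 0" using \<eta> by (simp add: L_def)
  have "\<forall>\<^sub>F q in sequentially. 4 * (1 / real q) \<le> \<eta> / 2" using \<eta> by real_asymp
  moreover note eventually_harm_error_le[OF D(1) assms(5), of L] eventually_gt_at_top[of "0::nat"]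
  ultimately have "\<forall>\<^sub>F q in sequentially. 4 * (1 / real q) \<le> \<eta> / 2 \<and>
      L * (1 / real q) * (32 + 48 * (harm (2 * D * q + 3 + 1))\<^sup>2) \<le> \<epsilon> \<and> 0 < q"
    by eventually_elim simp
  then obtain q where q: "q > 0" "4 * (1 / real q) \<le> \<eta> / 2"
      "L * (1 / real q) * (32 + 48 * (harm (2 * D * q + 3 + 1))\<^sup>2) \<le> \<epsilon>"
    using eventually_happens'[OF sequentially_bot] by blast
  define s where "s = 1 / real q"
  have s: "s > 0" "4 * s \<le> \<eta> / 2" using q by (auto simp: s_def)
  interpret square_grid s by standard (rule s)
  \<comment> \<open>The number of integers from \<open>- (D * q + 1)\<close> to
    \<open>D * q + 1\<close>, which by \<open>J_bound\<close> contain both indices of each cell in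
    \<open>J\<close>.\<close>
  define n where "n = 2 * D * q + 3"
  define F where "F z = of_real (cutoff K \<eta> z) * f z" for z
  define V where "V = {z. 2 * \<eta> < infdist z K}"
  \<comment> \<open>A cell lies within \<open>s\<close> of its centre, so the margin
    \<open>2 * s\<close> puts every other cell strictly beyond distance \<open>2 * \<eta>\<close>,
    inside \<open>V\<close>.\<close>
  define J where "J = {(k, l). infdist (centre k l) K < 2 * \<eta> + 2 * s}"
  have FV: "F z = f z" if "z \<in> V" for z using that \<eta> by (simp add: F_def V_def cutoff_eq_1)
  have VK: "V \<subseteq> - K" using \<eta> by (auto simp: V_def)
  have J_bound: "J \<subseteq> {- int (D * q + 1)..int (D * q + 1)} \<times> {- int (D * q + 1)..int (D * q + 1)}"
  proof clarify
    fix k l assume "(k, l) \<in> J"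
    then have "infdist (centre k l) K < 2 * \<eta> + 2 * s" by (simp add: J_def)
    moreover obtain x where x: "x \<in> K" "infdist (centre k l) K = dist (centre k l) x"
      using infdist_attains_inf[OF closed K(2)] by metis
    ultimately have "cmod (centre k l) \<le> real D"
      using B(1)[OF x(1)] norm_triangle_ineq2[of "centre k l" x] D(2) s \<eta> by (simp add: dist_norm)
    then have "\<bar>of_int k + 1 / 2\<bar> * s \<le> real D" "\<bar>of_int l + 1 / 2\<bar> * s \<le> real D"
      using abs_Re_le_cmod[of "centre k l"] abs_Im_le_cmod[of "centre k l"] s
      by (auto simp: abs_mult)
    then have "\<bar>of_int k + 1 / 2\<bar> \<le> real (D * q)" "\<bar>of_int l + 1 / 2\<bar> \<le> real (D * q)"
      using q(1) by (auto simp: s_def divide_le_eq)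
    then have "\<bar>k\<bar> \<le> int (D * q + 1)" "\<bar>l\<bar> \<le> int (D * q + 1)" by linarith+
    then show "k \<in> {- int (D * q + 1)..int (D * q + 1)} \<and> l \<in> {- int (D * q + 1)..int (D * q + 1)}"
      by auto
  qed
  then have finJ: "finite J" by (rule finite_subset) auto
  have "card J \<le> card ({- int (D * q + 1)..int (D * q + 1)} \<times> {- int (D * q + 1)..int (D * q + 1)})"
    by (rule card_mono[OF _ J_bound]) auto
  also have "\<dots> = n\<^sup>2"
    by (simp add: card_cartesian_product n_def power2_eq_square nat_add_distrib nat_mult_distrib algebra_simps)
  finally have cardJ: "card J \<le> n\<^sup>2" .
  interpret lipschitz_grid s F V J L c a
  proof
    show "cmod (F w - F z) \<le> L * cmod (w - z)" if "cmod (w - z) \<le> 4 * s" for w z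
      unfolding F_def L_def using that s(2) by (intro cutoff_mult_lipschitz closed hol bd \<eta>) auto
    have "f holomorphic_on V" using hol VK by (rule holomorphic_on_subset)
    then show "F holomorphic_on V" using FV holomorphic_cong by blast
    show "cell k l \<subseteq> V" if "(k, l) \<notin> J" for k l
    proof
      fix w assume "w \<in> cell k l"
      then show "w \<in> V"
        using that infdist_le_add_dist[of "centre k l" K w] cmod_diff_centre_le[of w k l] s(1)
        by (simp add: J_def V_def norm_minus_commute)
    qed
    have "\<forall>\<^sub>F z in at_infinity. z * (F z - c) = z * (f z - c)"
      unfolding eventually_at_infinity
    proof (intro exI[of _ "real D"] allI impI)
      fix z :: complex assume z: "real D \<le> cmod z"
      obtain x where x: "x \<in> K" "infdist z K = dist z x"
        using infdist_attains_inf[OF closed K(2)] by metis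
      have "z \<in> V"
        using z D(2) x B(1)[OF x(1)] norm_triangle_ineq2[of z x] \<eta> by (simp add: V_def dist_norm)
      then show "z * (F z - c) = z * (f z - c)" by (simp add: FV)
    qed
    then show "((\<lambda>z. z * (F z - c)) \<longlongrightarrow> a) at_infinity"
      using lim by (subst tendsto_cong)
  qed (use L finJ in auto)
  define P where "P = (\<lambda>(k, l). centre k l) ` J"
  \<comment> \<open>Less than half the mesh, so that the disks are disjoint, and equal to the
    distance from the centres required by \<open>approximation\<close>.\<close>
  define r where "r = s / 3"
  have r: "r > 0" using s by (simp add: r_def)
  have finP: "finite P" using finJ by (simp add: P_def)
  have comp: "compact (\<Union>p\<in>P. cball p r)" using finP by auto
  define g where "g z = c + (\<Sum>(k, l)\<in>J. coeff k l / (z - centre k l))" for z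
  have away: "r < cmod (z - centre k l)" if "z \<in> - (\<Union>p\<in>P. cball p r)" "(k, l) \<in> J" for z k l
    using that by (force simp: P_def dist_norm norm_minus_commute)
  have "cmod a \<le> (1 + \<epsilon>) * analytic_capacity (\<Union>p\<in>P. cball p r)"
  proof (rule le_analytic_capacity_scaled[OF comp])
    show "g holomorphic_on - (\<Union>p\<in>P. cball p r)"
      unfolding g_def case_prod_unfold using away r
      by (intro holomorphic_intros) fastforce+
    show "cmod (g z) \<le> 1 + \<epsilon>" if "z \<in> - (\<Union>p\<in>P. cball p r)" for z
    proof -
      have "cmod (F z - g z) \<le> L * s * (32 + 48 * (harm (n + 1))\<^sup>2)"
        unfolding g_def using away[OF that] by (intro approximation cardJ) (auto simp: n_def r_def)
      also have "\<dots> \<le> \<epsilon>" using q(3) by (simp add: n_def s_def)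
      finally have "cmod (F z - g z) \<le> \<epsilon>" .
      moreover have "cmod (F z) \<le> 1"
      \<comment> \<open>Points of \<open>K\<close> may lie outside all the disks. There
        \<open>f\<close> is not controlled, but the cutoff makes \<open>F\<close> vanish.\<close>
      proof (cases "z \<in> K")
        case True
        then show ?thesis using \<eta> by (simp add: F_def cutoff_eq_0)
      next
        case False
        then show ?thesis
          using bd[of z] cutoff_range[of K \<eta> z] unfolding F_def norm_mult
          by (intro mult_le_one) auto
      qed
      ultimately show ?thesis using norm_triangle_ineq2[of "g z" "F z"] by (simp add: norm_minus_commute)
    qed
    have "((\<lambda>z. \<Sum>(k, l)\<in>J. coeff k l / (1 - centre k l * inverse z)) \<longlongrightarrow>
        (\<Sum>(k, l)\<in>J. coeff k l / (1 - centre k l * 0))) at_infinity"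
      unfolding case_prod_unfold by (intro tendsto_intros tendsto_inverse_0) auto
    moreover have "\<forall>\<^sub>F z in at_infinity.
        (\<Sum>(k, l)\<in>J. coeff k l / (1 - centre k l * inverse z)) = z * (g z - c)"
      using eventually_not_equal_at_infinity[of 0]
    proof eventually_elim
      case (elim z)
      have "coeff k l / (1 - centre k l * inverse z) = z * (coeff k l / (z - centre k l))" for k l
        using elim by (simp add: divide_simps)
      then show ?case by (simp add: g_def sum_distrib_left case_prod_unfold)
    qed
    ultimately show "((\<lambda>z. z * (g z - c)) \<longlongrightarrow> a) at_infinity"
      using sum_coeff by (simp add: tendsto_cong)
  qed (use assms in auto)
  moreover have "2 * r < dist p p'" if "p \<in> P" "p' \<in> P" "p \<noteq> p'" for p p'
  proof -
    obtain k l k' l' where kl: "p = centre k l" "p' = centre k' l'" using \<open>p \<in> P\<close> \<open>p' \<in> P\<close> by (auto simp: P_def)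
    have "Re (p - p') = of_int (k - k') * s" "Im (p - p') = of_int (l - l') * s"
      by (simp_all add: kl algebra_simps)
    then have "\<bar>of_int (k - k')\<bar> * s \<le> cmod (p - p')" "\<bar>of_int (l - l')\<bar> * s \<le> cmod (p - p')"
      using abs_Re_le_cmod[of "p - p'"] abs_Im_le_cmod[of "p - p'"] s(1) by (simp_all add: abs_mult)
    moreover have "k \<noteq> k' \<or> l \<noteq> l'" using kl \<open>p \<noteq> p'\<close> by auto
    then have "1 * s \<le> \<bar>of_int (k - k')\<bar> * s \<or> 1 * s \<le> \<bar>of_int (l - l')\<bar> * s"
      using s(1) by (auto simp: mult_le_cancel_right)
    ultimately have "s \<le> dist p p'" unfolding dist_norm by linarith
    then show ?thesis using s(1) by (simp add: r_def)
  qed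
  moreover have "infdist p K < \<delta>" if "p \<in> P" for p
    using that s \<eta> by (auto simp: P_def J_def \<eta>_def)
  ultimately show ?thesis
    using that[of r P] r finP s \<eta> by (simp add: r_def \<eta>_def)
qed

section \<open>Reduction of subadditivity to disks\<close>

lemma disjoint_disk_union_UN:
  assumes "finite P" "\<And>p q. p \<in> P \<Longrightarrow> q \<in> P \<Longrightarrow> p \<noteq> q \<Longrightarrow> 2 * r < dist p q"
  shows "disjoint_disk_union r (\<Union>p\<in>P. cball p r)"
  unfolding disjoint_disk_union_def
proof (intro exI conjI)
  have False if "p \<in> P" "q \<in> P" "p \<noteq> q" "z \<in> cball p r" "z \<in> cball q r" for p q z
    using assms(2)[OF that(1-3)] that dist_triangle2[of p q z] by auto
  then show "pairwise disjnt ((\<lambda>p. cball p r) ` P)"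
    unfolding pairwise_def disjnt_iff by blast
qed (use assms in auto)

theorem theorem4p2:
  "(\<forall>E F :: complex set. compact E \<and> compact F \<longrightarrow>
       analytic_capacity (E \<union> F) \<le> analytic_capacity E + analytic_capacity F)
   \<longleftrightarrow>
   (\<forall>E F :: complex set. compact E \<and> compact F \<and> E \<inter> F = {} \<and>
       (\<exists>r>0. disjoint_disk_union r E \<and> disjoint_disk_union r F) \<longrightarrow>
       analytic_capacity (E \<union> F) \<le> analytic_capacity E + analytic_capacity F)"
proof (intro iffI allI impI)
  fix E F :: "complex set"
  assume disks: "\<forall>E F :: complex set. compact E \<and> compact F \<and> E \<inter> F = {} \<and>
       (\<exists>r>0. disjoint_disk_union r E \<and> disjoint_disk_union r F) \<longrightarrow>
       analytic_capacity (E \<union> F) \<le> analytic_capacity E + analytic_capacity F"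
    and EF: "compact E \<and> compact F"
  define S where "S = analytic_capacity E + analytic_capacity F"
  \<comment> \<open>All losses are collected here: \<epsilon> twice from outer regularity and the
    factor 1 + \<epsilon> from the discretization.\<close>
  have approx: "cmod a \<le> (1 + \<epsilon>) * (S + 2 * \<epsilon>)"
    if "E \<union> F \<noteq> {}" and f: "admissible (E \<union> F) f c a" and "\<epsilon> > 0" for f c a \<epsilon>
  proof -
    obtain \<delta>1 where \<delta>1: "\<delta>1 > 0" "analytic_capacity (\<Union>x\<in>E. cball x \<delta>1) \<le> analytic_capacity E + \<epsilon>"
      using analytic_capacity_outer_regular EF \<open>\<epsilon> > 0\<close> by metis
    obtain \<delta>2 where \<delta>2: "\<delta>2 > 0" "analytic_capacity (\<Union>x\<in>F. cball x \<delta>2) \<le> analytic_capacity F + \<epsilon>"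
      using analytic_capacity_outer_regular EF \<open>\<epsilon> > 0\<close> by metis
    \<comment> \<open>Disks of radius at most \<delta> with centres within \<delta> of a set lie in
      its \<open>2 * \<delta>\<close>-neighbourhood, hence the half.\<close>
    define \<delta> where "\<delta> = min \<delta>1 \<delta>2 / 2"
    have \<delta>: "\<delta> > 0" using \<delta>1 \<delta>2 by (simp add: \<delta>_def)
    have comp: "compact (E \<union> F)" using EF by (simp add: compact_Un)
    obtain r P where r: "0 < r" "r \<le> \<delta>" and finP: "finite P"
      and inf: "\<And>p. p \<in> P \<Longrightarrow> infdist p (E \<union> F) < \<delta>"
      and sep: "\<And>p q. p \<in> P \<Longrightarrow> q \<in> P \<Longrightarrow> p \<noteq> q \<Longrightarrow> 2 * r < dist p q"
      and a: "cmod a \<le> (1 + \<epsilon>) * analytic_capacity (\<Union>p\<in>P. cball p r)"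
      using disk_approximation[OF comp \<open>E \<union> F \<noteq> {}\<close> f \<delta> \<open>\<epsilon> > 0\<close>] by metis
    \<comment> \<open>Disks close to both sets are counted with \<open>E\<close> only, so the two
      groups are disjoint even if \<open>E\<close> and \<open>F\<close> meet.\<close>
    define P1 where "P1 = {p \<in> P. \<exists>x\<in>E. dist x p < \<delta>}"
    define P2 where "P2 = P - P1"
    let ?U = "\<lambda>P. \<Union>p\<in>P. cball p r"
    have fin: "finite P1" "finite P2" and sub: "P1 \<subseteq> P" "P2 \<subseteq> P"
      using finP by (auto simp: P1_def P2_def)
    have comp': "compact (?U P1)" "compact (?U P2)" using fin by auto
    have near2: "\<exists>x\<in>F. dist x p < \<delta>" if "p \<in> P2" for p
    proof -
      have "p \<in> P" using that by (simp add: P2_def)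
      obtain x where "x \<in> E \<union> F" "infdist p (E \<union> F) = dist p x"
        using infdist_attains_inf[OF compact_imp_closed[OF comp] \<open>E \<union> F \<noteq> {}\<close>] by metis
      then show ?thesis
        using inf[OF \<open>p \<in> P\<close>] that by (auto simp: P1_def P2_def dist_commute)
    qed
    have thick: "?U Q \<subseteq> (\<Union>x\<in>G. cball x \<delta>')"
      if "\<And>p. p \<in> Q \<Longrightarrow> \<exists>x\<in>G. dist x p < \<delta>" "2 * \<delta> \<le> \<delta>'" for Q G \<delta>'
    proof clarify
      fix z p assume "p \<in> Q" and z: "z \<in> cball p r"
      from that(1)[OF \<open>p \<in> Q\<close>] obtain x where "x \<in> G" "dist x p < \<delta>" by blast
      then show "z \<in> (\<Union>x\<in>G. cball x \<delta>')"
        using z r(2) that(2) dist_triangle[of x z p] by force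
    qed
    have cap1: "analytic_capacity (?U P1) \<le> analytic_capacity E + \<epsilon>"
      using \<delta>1(2) EF
      by (intro order_trans[OF analytic_capacity_mono[OF comp'(1) compact_minkowski_sum_cball thick]])
         (auto simp: P1_def \<delta>_def)
    have cap2: "analytic_capacity (?U P2) \<le> analytic_capacity F + \<epsilon>"
      using \<delta>2(2) EF near2
      by (intro order_trans[OF analytic_capacity_mono[OF comp'(2) compact_minkowski_sum_cball thick]])
         (auto simp: \<delta>_def)
    have "?U P1 \<inter> ?U P2 = {}"
    proof -
      have False if "p \<in> P1" "q \<in> P2" "z \<in> cball p r" "z \<in> cball q r" for p q z
        using sep[of p q] that sub dist_triangle2[of p q z] by (auto simp: P2_def dist_commute)
      then show ?thesis by blast
    qed
    moreover have "disjoint_disk_union r (?U P1)" "disjoint_disk_union r (?U P2)"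
      by (intro disjoint_disk_union_UN fin sep; use sub in blast)+
    ultimately have "analytic_capacity (?U P1 \<union> ?U P2) \<le> analytic_capacity (?U P1) + analytic_capacity (?U P2)"
      using disks comp' r(1) by blast
    moreover have "?U P1 \<union> ?U P2 = ?U P" by (auto simp: P1_def P2_def)
    ultimately have "analytic_capacity (?U P) \<le> S + 2 * \<epsilon>"
      using cap1 cap2 by (simp add: S_def)
    then have "(1 + \<epsilon>) * analytic_capacity (?U P) \<le> (1 + \<epsilon>) * (S + 2 * \<epsilon>)"
      using \<open>\<epsilon> > 0\<close> by (intro mult_left_mono) auto
    then show ?thesis using a by linarith
  qed
  show "analytic_capacity (E \<union> F) \<le> analytic_capacity E + analytic_capacity F"
  \<comment> \<open>\<open>disk_approximation\<close> is stated for nonempty sets; for empty ones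
    nonnegativity of the capacity suffices.\<close>
  proof (cases "E \<union> F = {}")
    case True
    then show ?thesis using analytic_capacity_nonneg[of "{}"] by simp
  next
    case False
    have "cmod a \<le> S" if "admissible (E \<union> F) f c a" for f c a
    proof (rule tendsto_lowerbound)
      \<comment> \<open>The bound holds for every positive \<epsilon>, so \<epsilon> may tend to 0
        from the right.\<close>
      show "((\<lambda>\<epsilon>. (1 + \<epsilon>) * (S + 2 * \<epsilon>)) \<longlongrightarrow> S) (at_right 0)"
        by (auto intro!: tendsto_eq_intros)
      show "\<forall>\<^sub>F \<epsilon> in at_right 0. cmod a \<le> (1 + \<epsilon>) * (S + 2 * \<epsilon>)"
        using eventually_at_right_less[of 0] by eventually_elim (use approx[OF False that] in auto)
    qed auto
    then show ?thesis
      unfolding S_def[symmetric] using EF by (intro analytic_capacity_le) (auto simp: compact_Un)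
  qed
qed auto

end
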